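(* Let $X$ be a real Banach space which is $\omega$-LUR. Assume that (i) there exists a big point $u\in S_X$, and (ii) for each $\epsilon>0$ there exists a closed subspace $Z_\epsilon\subset X$ of codimension $1$ and a linear projection of $X$ onto $Z_\epsilon$ of norm at most $1+\epsilon$. Then $X$ is isometrically a Hilbert space.
   Context: $X$ is $\omega$-LUR if every $x\in S_X$ is an $\omega$-LUR point: for every $(x_n)\subset B_X$ with $\|x+x_n\|\to2$ one has $x_n\to x$ weakly. $\mathcal{G}_X$ is the group of surjective linear isometries of $X$; $x\in S_X$ is a big point if $\overline{\mathrm{conv}}(\{T(x):T\in\mathcal{G}_X\})=B_X$. *)

theory Defs
  imports "HOL-Analysis.Analysis"
begin

definition weakly_tendsto :: "(nat \<Rightarrow> 'a::real_normed_vector) \<Rightarrow> 'a \<Rightarrow> bool" where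
  "weakly_tendsto xs x \<longleftrightarrow>
     (\<forall>f :: 'a \<Rightarrow> real. bounded_linear f \<longrightarrow> (\<lambda>n. f (xs n)) \<longlonglongrightarrow> f x)"

definition omega_LUR_point :: "'a::real_normed_vector \<Rightarrow> bool" where
  "omega_LUR_point x \<longleftrightarrow> norm x = 1 \<and>
     (\<forall>xs :: nat \<Rightarrow> 'a. (\<forall>n. norm (xs n) \<le> 1) \<longrightarrow>
        (\<lambda>n. norm (x + xs n)) \<longlonglongrightarrow> 2 \<longrightarrow> weakly_tendsto xs x)"

definition omega_LUR :: "'a::real_normed_vector itself \<Rightarrow> bool" where
  "omega_LUR _ \<longleftrightarrow> (\<forall>x :: 'a. norm x = 1 \<longrightarrow> omega_LUR_point x)"

definition isometry_group :: "('a::real_normed_vector \<Rightarrow> 'a) set" where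
  "isometry_group = {T. linear T \<and> surj T \<and> (\<forall>x. norm (T x) = norm x)}"

definition big_point :: "'a::real_normed_vector \<Rightarrow> bool" where
  "big_point u \<longleftrightarrow> norm u = 1 \<and>
     closure (convex hull {T u | T. T \<in> isometry_group}) = cball 0 1"

definition codim1_closed_subspace :: "'a::real_normed_vector set \<Rightarrow> bool" where
  "codim1_closed_subspace Z \<longleftrightarrow> subspace Z \<and> closed Z \<and>
     (\<exists>v. v \<notin> Z \<and> span (insert v Z) = UNIV)"

definition is_projection_onto_with_norm :: "('a::real_normed_vector \<Rightarrow> 'a) \<Rightarrow> 'a set \<Rightarrow> real \<Rightarrow> bool" where
  "is_projection_onto_with_norm P Z c \<longleftrightarrow> linear P \<and> range P = Z \<and>
     (\<forall>z\<in>Z. P z = z) \<and> (\<forall>x. norm (P x) \<le> c * norm x)"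

text \<open>The norm is induced by an inner product (the space is isometrically Hilbert,
  completeness being given by the type class).\<close>
definition norm_from_inner_product :: "'a::real_normed_vector itself \<Rightarrow> bool" where
  "norm_from_inner_product _ \<longleftrightarrow> (\<exists>ip :: 'a \<Rightarrow> 'a \<Rightarrow> real.
     (\<forall>y. linear (\<lambda>x. ip x y)) \<and> (\<forall>x y. ip x y = ip y x) \<and>
     (\<forall>x. norm x = sqrt (ip x x)))"

end

theory Submission
  imports Defs
begin

text \<open>
  Every unit vector \<open>u\<close> spans the kernel of a norm-one projection, at least on each
  three-dimensional subspace: conjugating the given projections by isometries, their kernels
  converge weakly to the line through \<open>u\<close> while the defining functionals stay bounded away from 0
  at \<open>u\<close>. Equivalently, the vectors Birkhoff orthogonal to a given direction form a plane. By
  strict convexity the map from directions to planes preserves coplanarity and is injective, so by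
  the fundamental theorem of projective geometry it is given by a bilinear form \<open>B\<close>. Comparing
  logarithmic derivatives of the norm and of \<open>B z z\<close> along closed curves yields that the squared
  norm is a multiple of \<open>B z z\<close>, hence the parallelogram law. Two-dimensional spaces are
  treated by an extremal ellipse.
\<close>

section \<open>Norming functionals\<close>

text \<open>The parallelogram law concerns two vectors, so a third independent one suffices to work
  in dimension three. There only the restrictions of the defining functionals have to converge, and
  a compact box provides this. The kernels of the conjugated projections need not lie in the chosen
  subspace and converge only weakly, so the limiting estimate comes from weak lower semicontinuity
  of the norm in the whole space. Continuity of the map from directions to planes is replaced by
  closedness of Birkhoff orthogonality; smoothness of the norm is replaced by support inequalities
  that squeeze difference quotients along curves. The form \<open>B\<close> comes from a
  collineation and may a priori have a skew part; it is this part that periodicity excludes.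
  Dimension two is really different: there a hyperplane is a line, and Hahn-Banach gives a norm-one
  projection onto every line of every normed plane.\<close>

definition norm_dominated_graph :: "('a::real_normed_vector \<times> real) set \<Rightarrow> bool" where
  "norm_dominated_graph G \<longleftrightarrow> subspace G \<and> (\<forall>(x, r)\<in>G. r \<le> norm x)"

lemma norm_dominated_graph_Union:
  assumes "\<C> \<noteq> {}" and "subset.chain {G. norm_dominated_graph G} \<C>"
  shows "norm_dominated_graph (\<Union>\<C>)"
proof -
  have G: "norm_dominated_graph G" if "G \<in> \<C>" for G
    using assms that by (auto simp: subset_chain_def)
  have cmp: "G \<subseteq> G' \<or> G' \<subseteq> G" if "G \<in> \<C>" "G' \<in> \<C>" for G G'
    using assms that by (auto simp: subset_chain_def)
  have "subspace (\<Union>\<C>)"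
    unfolding subspace_def
  proof (intro conjI ballI allI)
    show "0 \<in> \<Union>\<C>"
      using assms(1) G by (auto simp: norm_dominated_graph_def subspace_def)
  next
    fix a b assume "a \<in> \<Union>\<C>" "b \<in> \<Union>\<C>"
    then obtain G G' where "G \<in> \<C>" "a \<in> G" "G' \<in> \<C>" "b \<in> G'" by auto
    then obtain G'' where "G'' \<in> \<C>" "a \<in> G''" "b \<in> G''"
      using cmp by blast
    then show "a + b \<in> \<Union>\<C>"
      using G[of G''] by (auto simp: norm_dominated_graph_def subspace_def)
  next
    fix c :: real and a assume "a \<in> \<Union>\<C>"
    then show "c *\<^sub>R a \<in> \<Union>\<C>"
      using G by (auto simp: norm_dominated_graph_def subspace_def)
  qed
  then show ?thesis
    using G by (fastforce simp: norm_dominated_graph_def)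
qed

text \<open>Domination bounds the new value \<open>\<xi>\<close> from below through
  \<open>m - y\<close> and from above through \<open>m + y\<close>; the triangle inequality puts
  each lower bound under each upper bound. Scaling reduces every coefficient \<open>t\<close> of
  \<open>y\<close> to these two.\<close>

lemma norm_dominated_graph_extend:
  fixes G :: "('a::real_normed_vector \<times> real) set"
  assumes G: "norm_dominated_graph G"
  obtains \<xi> where "norm_dominated_graph {m + t *\<^sub>R (y, \<xi>) | m t. m \<in> G}"
proof -
  define lo where "lo = (\<lambda>m::'a \<times> real. snd m - norm (fst m - y))"
  define \<xi> where "\<xi> = (SUP m\<in>G. lo m)"
  have sub: "subspace G" and dom: "\<And>m. m \<in> G \<Longrightarrow> snd m \<le> norm (fst m)"
    using G by (auto simp: norm_dominated_graph_def)
  have gap: "lo m \<le> norm (fst m' + y) - snd m'" if "m \<in> G" "m' \<in> G" for m m'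
  proof -
    have "snd m + snd m' \<le> norm (fst m + fst m')"
      using dom[of "m + m'"] subspace_add[OF sub that] by simp
    also have "\<dots> \<le> norm (fst m - y) + norm (fst m' + y)"
      using norm_triangle_ineq[of "fst m - y" "fst m' + y"] by simp
    finally show ?thesis by (simp add: lo_def)
  qed
  have "0 \<in> G" using sub by (rule subspace_0)
  have ub: "\<xi> \<le> norm (fst m + y) - snd m" if "m \<in> G" for m
    unfolding \<xi>_def using \<open>0 \<in> G\<close> gap that by (intro cSUP_least) auto
  have lb: "lo m \<le> \<xi>" if "m \<in> G" for m
    unfolding \<xi>_def using gap[OF _ \<open>0 \<in> G\<close>] that
    by (intro cSUP_upper bdd_aboveI2[where M = "norm y"]) auto
  have bound: "snd m + t * \<xi> \<le> norm (fst m + t *\<^sub>R y)" if m: "m \<in> G" for m t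
  proof -
    consider "t = 0" | "t > 0" | "t < 0" by linarith
    then show ?thesis
    proof cases
      case 1 then show ?thesis using dom m by simp
    next
      case 2
      have "\<xi> \<le> norm (fst m /\<^sub>R t + y) - snd m / t"
        using ub[OF subspace_scale[OF sub m, of "inverse t"]] by (simp add: divide_inverse mult.commute)
      then have "t * \<xi> \<le> t * norm (fst m /\<^sub>R t + y) - snd m"
        using 2 by (simp add: field_simps)
      also have "t * norm (fst m /\<^sub>R t + y) = norm (t *\<^sub>R (fst m /\<^sub>R t + y))"
        using 2 by simp
      also have "t *\<^sub>R (fst m /\<^sub>R t + y) = fst m + t *\<^sub>R y"
        using 2 by (simp add: scaleR_add_right)
      finally show ?thesis by simp
    next
      case 3
      have "snd m / (-t) - norm (fst m /\<^sub>R (-t) - y) \<le> \<xi>"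
        using lb[OF subspace_scale[OF sub m, of "inverse (-t)"]]
        by (simp add: lo_def divide_inverse mult.commute)
      then have "(-t) * (snd m / (-t) - norm (fst m /\<^sub>R (-t) - y)) \<le> (-t) * \<xi>"
        using 3 by (intro mult_left_mono) auto
      then have "snd m - (-t) * norm (fst m /\<^sub>R (-t) - y) \<le> (-t) * \<xi>"
        using 3 by (simp add: right_diff_distrib)
      also have "(-t) * norm (fst m /\<^sub>R (-t) - y) = norm ((-t) *\<^sub>R (fst m /\<^sub>R (-t) - y))"
        using 3 by simp
      also have "(-t) *\<^sub>R (fst m /\<^sub>R (-t) - y) = fst m + t *\<^sub>R y"
        using 3 by (simp add: scaleR_diff_right)
      finally show ?thesis by simp
    qed
  qed
  have "subspace {m + t *\<^sub>R (y, \<xi>) | m t. m \<in> G}"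
  proof -
    have "{m + t *\<^sub>R (y, \<xi>) | m t. m \<in> G} = {a + b |a b. a \<in> G \<and> b \<in> span {(y, \<xi>)}}"
      unfolding span_singleton by blast
    then show ?thesis using subspace_sums[OF sub subspace_span] by simp
  qed
  then have "norm_dominated_graph {m + t *\<^sub>R (y, \<xi>) | m t. m \<in> G}"
    using bound by (fastforce simp: norm_dominated_graph_def)
  then show thesis by (rule that)
qed

text \<open>Hahn-Banach by Zorn's lemma, starting from the line through \<open>(x, norm x)\<close>.
  Extending a maximal dominated graph by an arbitrary \<open>y\<close> must give it back, so
  \<open>y\<close> is in its domain.\<close>

theorem norming_functional:
  fixes x :: "'a::real_normed_vector"
  obtains f :: "'a \<Rightarrow> real"
  where "bounded_linear f" "f x = norm x" "\<And>y. \<bar>f y\<bar> \<le> norm y"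
proof -
  define G0 where "G0 = span {(x, norm x)}"
  have G0: "norm_dominated_graph G0"
  proof -
    have "t * norm x \<le> norm (t *\<^sub>R x)" for t
      by (simp add: mult_right_mono)
    then show ?thesis
      unfolding norm_dominated_graph_def G0_def using subspace_span[of "{(x, norm x)}"]
      by (auto simp: span_singleton)
  qed
  define \<A> where "\<A> = {G. norm_dominated_graph G \<and> G0 \<subseteq> G}"
  have "\<exists>M\<in>\<A>. \<forall>X\<in>\<A>. M \<subseteq> X \<longrightarrow> X = M"
  proof (rule subset_Zorn_nonempty)
    show "\<A> \<noteq> {}" using G0 by (auto simp: \<A>_def)
    fix \<C> assume C: "\<C> \<noteq> {}" "subset.chain \<A> \<C>"
    then have "subset.chain {G. norm_dominated_graph G} \<C>"
      unfolding subset_chain_def \<A>_def by blast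
    then have "norm_dominated_graph (\<Union>\<C>)"
      by (rule norm_dominated_graph_Union[OF C(1)])
    moreover obtain G where "G \<in> \<C>" "G0 \<subseteq> G"
      using C unfolding subset_chain_def \<A>_def by blast
    ultimately show "\<Union>\<C> \<in> \<A>"
      unfolding \<A>_def by (simp add: Union_upper[THEN order_trans[rotated]])
  qed
  then obtain M where MA: "M \<in> \<A>" and "\<forall>X\<in>\<A>. M \<subseteq> X \<longrightarrow> X = M"
    by (elim bexE)
  then have max: "X = M" if "norm_dominated_graph X" "M \<subseteq> X" for X
    using that order_trans[of G0 M X] unfolding \<A>_def by simp
  have M: "norm_dominated_graph M" "G0 \<subseteq> M" using MA by (simp_all add: \<A>_def)
  have sub: "subspace M" and dom: "\<And>y r. (y, r) \<in> M \<Longrightarrow> r \<le> norm y"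
    using M by (auto simp: norm_dominated_graph_def)
  have ex: "\<exists>r. (y, r) \<in> M" for y
  proof -
    obtain \<xi> where \<xi>: "norm_dominated_graph {m + t *\<^sub>R (y, \<xi>) | m t. m \<in> M}"
      using norm_dominated_graph_extend[OF M(1)] .
    have "M \<subseteq> {m + t *\<^sub>R (y, \<xi>) | m t. m \<in> M}"
      by (rule subsetI, rule CollectI) (metis add_0_right scaleR_zero_left)
    then have "{m + t *\<^sub>R (y, \<xi>) | m t. m \<in> M} = M"
      using max \<xi> by blast
    moreover have "(y, \<xi>) \<in> {m + t *\<^sub>R (y, \<xi>) | m t. m \<in> M}"
      using subspace_0[OF sub] by (intro CollectI) (metis add_0_left scaleR_one)
    ultimately show ?thesis by blast
  qed
  \<comment> \<open>Single-valuedness need not be part of the definition: \<open>(0, r - s)\<close>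
    and its negative lie in the subspace, and domination bounds both values by 0.\<close>
  have uniq: "r = s" if "(y, r) \<in> M" "(y, s) \<in> M" for y r s
    using dom[of 0 "r - s"] dom[of 0 "s - r"] subspace_diff[OF sub that]
      subspace_diff[OF sub that(2,1)] by simp
  define f where "f y = (THE r. (y, r) \<in> M)" for y
  have f: "(y, f y) \<in> M" for y
    unfolding f_def using ex uniq by (metis (mono_tags, lifting) theI')
  have f_eq: "f y = r" if "(y, r) \<in> M" for y r
    using uniq f that by blast
  have abs: "\<bar>f y\<bar> \<le> norm y" for y
    using dom[OF f[of y]] dom[of "- y" "- f y"] subspace_neg[OF sub f[of y]] by auto
  show thesis
  proof
    show "bounded_linear f"
    proof (rule bounded_linear_intro[where K = 1])
      show "f (a + b) = f a + f b" for a b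
        using subspace_add[OF sub f[of a] f[of b]] by (auto intro: f_eq)
      show "f (r *\<^sub>R a) = r *\<^sub>R f a" for r a
        using subspace_scale[OF sub f[of a], of r] by (auto intro: f_eq)
      show "norm (f a) \<le> norm a * 1" for a using abs by simp
    qed
    show "f x = norm x"
      using M(2) span_base[of "(x, norm x)" "{(x, norm x)}"] unfolding G0_def by (intro f_eq) blast
    show "\<And>y. \<bar>f y\<bar> \<le> norm y" by (rule abs)
  qed
qed

section \<open>Weak convergence and the isometry group\<close>

lemma weakly_tendstoD:
  fixes f :: "'a::real_normed_vector \<Rightarrow> real"
  shows "weakly_tendsto xs x \<Longrightarrow> bounded_linear f \<Longrightarrow> (\<lambda>n. f (xs n)) \<longlonglongrightarrow> f x"
  by (simp add: weakly_tendsto_def)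

text \<open>Weak lower semicontinuity of the norm, tested on a functional that norms the limit. The
  bound varies with \<open>n\<close> so that factors such as \<open>1 + 1 / Suc n\<close> can pass
  to the limit.\<close>

lemma weakly_tendsto_norm_le:
  assumes "weakly_tendsto xs x" and "\<And>n. norm (xs n) \<le> c n" and "c \<longlonglongrightarrow> C"
  shows "norm x \<le> C"
proof -
  obtain f :: "'a \<Rightarrow> real" where f: "bounded_linear f" "f x = norm x" "\<And>y. \<bar>f y\<bar> \<le> norm y"
    using norming_functional[of x] by blast
  have "(\<lambda>n. f (xs n)) \<longlonglongrightarrow> f x"
    using assms(1) f(1) by (rule weakly_tendstoD)
  moreover have "\<forall>n\<ge>0. f (xs n) \<le> c n"
    using f(3) assms(2) by (meson abs_le_D1 order_trans)
  ultimately have "f x \<le> C"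
    using assms(3) by (intro LIMSEQ_le[of "\<lambda>n. f (xs n)" _ c]) blast+
  then show ?thesis using f(2) by simp
qed

lemma weakly_tendsto_bounded_linear:
  assumes "weakly_tendsto xs x" "bounded_linear T"
  shows "weakly_tendsto (\<lambda>n. T (xs n)) (T x)"
  unfolding weakly_tendsto_def
proof (intro allI impI)
  fix f :: "'b \<Rightarrow> real" assume "bounded_linear f"
  then have "bounded_linear (\<lambda>x. f (T x))" using assms(2) by (rule bounded_linear_compose)
  from weakly_tendstoD[OF assms(1) this]
  show "(\<lambda>n. f (T (xs n))) \<longlonglongrightarrow> f (T x)" .
qed

lemma weakly_tendsto_add_const:
  assumes "weakly_tendsto xs x"
  shows "weakly_tendsto (\<lambda>n. v + xs n) (v + x)"
  using assms unfolding weakly_tendsto_def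
  by (simp add: linear_add[OF bounded_linear.linear] tendsto_add)

section \<open>Strict convexity from weak local uniform rotundity\<close>

lemma omega_LUR_D:
  assumes "omega_LUR TYPE('a::real_normed_vector)" "norm (x::'a) = 1"
    "\<And>n. norm (xs n) \<le> 1" "(\<lambda>n. norm (x + xs n)) \<longlonglongrightarrow> 2"
  shows "weakly_tendsto xs x"
  using assms by (auto simp: omega_LUR_def omega_LUR_point_def)

text \<open>The constant sequence \<open>y\<close> is admissible in the rotundity condition at
  \<open>x\<close>, and functionals separate \<open>y\<close> from any other weak limit.\<close>

lemma omega_LUR_strictly_convex_unit:
  assumes "omega_LUR TYPE('a::real_normed_vector)"
    and "norm (x::'a) = 1" "norm y = 1" "norm (x + y) = 2"
  shows "x = y"
proof -
  have w: "weakly_tendsto (\<lambda>_. y) x"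
    using assms by (intro omega_LUR_D) auto
  obtain f :: "'a \<Rightarrow> real" where f: "bounded_linear f" "f (x - y) = norm (x - y)"
    using norming_functional[of "x - y"] by metis
  have "f y = f x"
    using weakly_tendstoD[OF w f(1)] by (simp add: LIMSEQ_const_iff)
  then show ?thesis
    using f(2) by (simp add: linear_diff[OF bounded_linear.linear[OF f(1)]])
qed

lemma omega_LUR_strictly_convex:
  assumes "omega_LUR TYPE('a::real_normed_vector)"
    and "norm (x::'a) = norm y" "norm (x + y) \<ge> norm x + norm y"
  shows "x = y"
proof (cases "x = 0")
  case False
  have "x /\<^sub>R norm x = y /\<^sub>R norm x"
  proof (rule omega_LUR_strictly_convex_unit[OF assms(1)])
    have "norm (x + y) = 2 * norm x"
      using assms(2,3) norm_triangle_ineq[of x y] by simp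
    moreover have "norm (x /\<^sub>R norm x + y /\<^sub>R norm x) = norm (x + y) / norm x"
      by (simp flip: scaleR_add_right add: divide_inverse)
    ultimately show "norm (x /\<^sub>R norm x + y /\<^sub>R norm x) = 2"
      using False by simp
    show "norm (x /\<^sub>R norm x) = 1" "norm (y /\<^sub>R norm x) = 1" using False assms(2) by (auto simp: divide_simps)
  qed
  then show ?thesis using False by simp
qed (use assms in auto)

section \<open>Isometries and their orbits\<close>

lemma isometry_group_inv:
  assumes "T \<in> isometry_group"
  shows "inv T \<in> isometry_group" "inv T (T x) = x" "T (inv T x) = x"
proof -
  have T: "linear T" "surj T" "\<And>x. norm (T x) = norm x"
    using assms by (auto simp: isometry_group_def)
  have inj: "inj T"
    unfolding linear_injective_0[OF T(1)] by (metis norm_eq_zero T(3))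
  show 1: "inv T (T x) = x" for x using inj by simp
  show 2: "T (inv T x) = x" for x using T(2) by (simp add: surj_f_inv_f)
  have "linear (inv T)"
  proof (rule linearI)
    show "inv T (a + b) = inv T a + inv T b" for a b
      using 1[of "inv T a + inv T b"] by (simp add: linear_add[OF T(1)] 2)
    show "inv T (c *\<^sub>R a) = c *\<^sub>R inv T a" for c a
      using 1[of "c *\<^sub>R inv T a"] by (simp add: linear_scale[OF T(1)] 2)
  qed
  moreover have "surj (inv T)" using inj by (rule inj_imp_surj_inv)
  moreover have "norm (inv T x) = norm x" for x by (metis 2 T(3))
  ultimately show "inv T \<in> isometry_group" by (auto simp: isometry_group_def)
qed

lemma isometry_group_comp:
  assumes "T \<in> isometry_group" "S \<in> isometry_group"
  shows "T \<circ> S \<in> isometry_group"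
  using assms linear_compose[of S T] comp_surj[of S T] unfolding isometry_group_def by simp

lemma isometry_group_bounded_linear:
  "T \<in> isometry_group \<Longrightarrow> bounded_linear T"
  by (rule bounded_linear_intro[where K = 1]) (simp_all add: isometry_group_def linear_add linear_scale)

lemma isometry_group_linear: "T \<in> isometry_group \<Longrightarrow> linear T"
  and isometry_group_norm: "T \<in> isometry_group \<Longrightarrow> norm (T x) = norm x"
  by (auto simp: isometry_group_def)

text \<open>Otherwise the orbit lies in the ball of radius \<open>2 - e\<close> about
  \<open>- v\<close>. This ball is closed and convex, so it contains the whole unit ball, in
  particular \<open>v\<close> at distance 2 from \<open>- v\<close>.\<close>

lemma big_point_norm_add_isometry:
  assumes "big_point u" "norm v = 1" "e > 0"
  shows "\<exists>T\<in>isometry_group. norm (v + T u) > 2 - e"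
proof (rule ccontr)
  assume "\<not> ?thesis"
  then have "{T u | T. T \<in> isometry_group} \<subseteq> cball (- v) (2 - e)"
    by (force simp: dist_norm norm_minus_commute add.commute)
  then have "convex hull {T u | T. T \<in> isometry_group} \<subseteq> cball (- v) (2 - e)"
    by (intro hull_minimal) auto
  then have "cball 0 1 \<subseteq> cball (- v) (2 - e)"
    using closure_minimal[OF _ closed_cball, of "convex hull {T u | T. T \<in> isometry_group}" "- v" "2 - e"]
      assms(1) unfolding big_point_def by (elim conjE) simp
  then have "v \<in> cball (- v) (2 - e)" by (rule subsetD) (simp add: assms(2))
  moreover have "dist (- v) v = 2"
  proof -
    have "- v - v = (- 2) *\<^sub>R v" by (simp add: scaleR_2)
    then show ?thesis using assms(2) by (simp add: dist_norm)
  qed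
  ultimately show False using assms(3) by simp
qed

text \<open>Weak limits transfer the approximation property from the given big point to every unit
  vector: if \<^term>\<open>u\<close> is the weak limit of images of \<^term>\<open>y\<close>, a bound on all
  \<^term>\<open>norm (v + T y)\<close> persists for \<^term>\<open>norm (v + T u)\<close>.\<close>
lemma omega_LUR_norm_add_isometry:
  assumes LUR: "omega_LUR TYPE('a::real_normed_vector)"
    and u: "big_point (u::'a)" and "norm (y::'a) = 1" "norm (v::'a) = 1" "e > 0"
  shows "\<exists>T\<in>isometry_group. norm (v + T y) > 2 - e"
proof (rule ccontr)
  assume "\<not> ?thesis"
  then have le: "norm (v + T y) \<le> 2 - e" if "T \<in> isometry_group" for T
    using that by force
  have nu: "norm u = 1" using u by (simp add: big_point_def)
  have "\<exists>T\<in>isometry_group. norm (y + T u) > 2 - 1 / real (Suc n)" for n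
    using big_point_norm_add_isometry[OF u assms(3)] by simp
  then obtain T where T: "\<And>n. T n \<in> isometry_group" "\<And>n. norm (y + T n u) > 2 - 1 / real (Suc n)"
    by metis
  \<comment> \<open>Pulling back by \<open>inv (T n)\<close> moves the near-alignment from
    \<open>y\<close> to \<open>u\<close>, so that rotundity at \<open>u\<close> applies to the
    vectors \<open>inv (T n) y\<close>.\<close>
  have T': "norm (u + inv (T n) y) = norm (y + T n u)" for n
  proof -
    have "T n (u + inv (T n) y) = y + T n u"
      using linear_add[OF isometry_group_linear[OF T(1)[of n]]] isometry_group_inv(3)[OF T(1)[of n]] by simp
    then show ?thesis using isometry_group_norm[OF T(1)[of n]] by metis
  qed
  have "weakly_tendsto (\<lambda>n. inv (T n) y) u"
  proof (rule omega_LUR_D[OF LUR nu])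
    show n1: "norm (inv (T n) y) \<le> 1" for n
      using isometry_group_norm[OF isometry_group_inv(1)[OF T(1)]] assms(3) by simp
    show "(\<lambda>n. norm (u + inv (T n) y)) \<longlonglongrightarrow> 2"
    proof (rule tendsto_sandwich[where f = "\<lambda>n. 2 - 1 / real (Suc n)" and h = "\<lambda>_. 2"])
      show "(\<lambda>n. 2 - 1 / real (Suc n)) \<longlonglongrightarrow> 2"
        using tendsto_diff[OF tendsto_const LIMSEQ_inverse_real_of_nat, of 2] by (simp add: inverse_eq_divide)
      show "\<forall>\<^sub>F n in sequentially. 2 - 1 / real (Suc n) \<le> norm (u + inv (T n) y)"
        using T(2) T' by (auto intro!: always_eventually less_imp_le)
      show "\<forall>\<^sub>F n in sequentially. norm (u + inv (T n) y) \<le> 2"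
        using norm_triangle_le n1 nu by (intro always_eventually allI norm_triangle_le) (smt (verit))
    qed auto
  qed
  note lim = this
  have w: "weakly_tendsto (\<lambda>n. v + S (inv (T n) y)) (v + S u)" if S: "S \<in> isometry_group" for S
    by (rule weakly_tendsto_add_const[OF weakly_tendsto_bounded_linear[OF lim isometry_group_bounded_linear[OF S]]])
  \<comment> \<open>\<open>S\<close> composed with \<open>inv (T n)\<close> is among the isometries
    covered by \<open>le\<close>; in the limit the bound reaches \<open>S u\<close>, against bigness
    of \<open>u\<close>.\<close>
  have "norm (v + S u) \<le> 2 - e" if S: "S \<in> isometry_group" for S
  proof (rule weakly_tendsto_norm_le[OF w[OF S]])
    show "norm (v + S (inv (T n) y)) \<le> 2 - e" for n
      using le[OF isometry_group_comp[OF S isometry_group_inv(1)[OF T(1)]]] by simp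
  qed (rule tendsto_const)
  then show False
    using big_point_norm_add_isometry[OF u assms(4,5)] by (metis not_less)
qed

text \<open>A weak substitute for transitivity. The norm condition is kept beside the weak limit
  because it survives the passage to inverse isometries.\<close>

lemma omega_LUR_orbit:
  assumes LUR: "omega_LUR TYPE('a::real_normed_vector)"
    and u: "big_point (u::'a)" and "norm (y::'a) = 1" "norm (v::'a) = 1"
  obtains T where "\<And>n. T n \<in> isometry_group" "(\<lambda>n. norm (v + T n y)) \<longlonglongrightarrow> 2"
    "weakly_tendsto (\<lambda>n. T n y) v"
proof -
  have "\<exists>T\<in>isometry_group. norm (v + T y) > 2 - 1 / real (Suc n)" for n
    using omega_LUR_norm_add_isometry[OF assms] by simp
  then obtain T where T: "\<And>n. T n \<in> isometry_group" "\<And>n. norm (v + T n y) > 2 - 1 / real (Suc n)"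
    by metis
  have n1: "norm (T n y) \<le> 1" for n
    using isometry_group_norm[OF T(1)] assms(3) by simp
  have lim: "(\<lambda>n. norm (v + T n y)) \<longlonglongrightarrow> 2"
  proof (rule tendsto_sandwich[where f = "\<lambda>n. 2 - 1 / real (Suc n)" and h = "\<lambda>_. 2"])
    show "(\<lambda>n. 2 - 1 / real (Suc n)) \<longlonglongrightarrow> 2"
      using tendsto_diff[OF tendsto_const LIMSEQ_inverse_real_of_nat, of 2] by (simp add: inverse_eq_divide)
    show "\<forall>\<^sub>F n in sequentially. 2 - 1 / real (Suc n) \<le> norm (v + T n y)"
      using T(2) by (auto intro!: always_eventually less_imp_le)
    show "\<forall>\<^sub>F n in sequentially. norm (v + T n y) \<le> 2"
      using n1 assms(4) by (intro always_eventually allI norm_triangle_le) (smt (verit))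
  qed auto
  show thesis
    using that[of T] T(1) lim omega_LUR_D[of v "\<lambda>n. T n y", OF LUR assms(4) n1 lim] by blast
qed

text \<open>\<open>v\<close> spans the kernel of \<open>P\<close> and \<open>f\<close> reads off the
  component along it; \<open>2 + e\<close> bounds the complementary map, the identity minus
  \<open>P\<close>.\<close>

lemma projection_onto_hyperplane_form:
  fixes P :: "'a::real_normed_vector \<Rightarrow> 'a"
  assumes "codim1_closed_subspace Z" "is_projection_onto_with_norm P Z (1 + e)"
  obtains f :: "'a \<Rightarrow> real" and v :: 'a
  where "linear f" "norm v = 1" "f v = 1" "\<And>x. P x = x - f x *\<^sub>R v"
    "\<And>x. \<bar>f x\<bar> \<le> (2 + e) * norm x"
proof -
  obtain v0 where v0: "v0 \<notin> Z" "span (insert v0 Z) = UNIV" and Z: "subspace Z"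
    using assms(1) by (auto simp: codim1_closed_subspace_def)
  have P: "linear P" "range P = Z" "\<And>z. z \<in> Z \<Longrightarrow> P z = z" "\<And>x. norm (P x) \<le> (1 + e) * norm x"
    using assms(2) by (auto simp: is_projection_onto_with_norm_def)
  define v1 where "v1 = v0 - P v0"
  define v where "v = v1 /\<^sub>R norm v1"
  have "v1 \<noteq> 0" using v0 P(2) by (auto simp: v1_def)
  then have nv: "norm v = 1" and v1: "v1 = norm v1 *\<^sub>R v" by (auto simp: v_def)
  have "\<exists>a. x - P x = a *\<^sub>R v" for x
  proof -
    have "x \<in> span (insert v0 Z)" using v0 by simp
    then obtain k where "x - k *\<^sub>R v0 \<in> Z"
      using Z by (auto simp: span_insert span_eq_iff[THEN iffD2])
    then have "P (x - k *\<^sub>R v0) = x - k *\<^sub>R v0" using P by simp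
    then have "x - P x = k *\<^sub>R v1"
      by (simp add: v1_def linear_diff[OF P(1)] linear_scale[OF P(1)] algebra_simps)
    then show ?thesis using v1 by (metis scaleR_scaleR)
  qed
  then obtain f where f: "\<And>x. x - P x = f x *\<^sub>R v" by metis
  have v_nz: "v \<noteq> 0" using nv by auto
  show thesis
  proof
    show "linear f"
    proof (rule linearI)
      fix a b c
      have "f (a + b) *\<^sub>R v = (f a + f b) *\<^sub>R v"
        by (simp add: scaleR_add_left flip: f) (simp add: linear_add[OF P(1)])
      then show "f (a + b) = f a + f b" using v_nz by simp
      have "f (c *\<^sub>R a) *\<^sub>R v = (c * f a) *\<^sub>R v"
        by (simp flip: f scaleR_scaleR) (simp add: linear_scale[OF P(1)] scaleR_diff_right)
      then show "f (c *\<^sub>R a) = c *\<^sub>R f a" using v_nz by simp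
    qed
    show "norm v = 1" by (rule nv)
    have "P (P v0) = P v0" using P(2,3) by blast
    then have "P v1 = 0" by (simp add: v1_def linear_diff[OF P(1)])
    then have "P v = 0" by (simp add: v_def linear_scale[OF P(1)])
    then show "f v = 1" using f[of v] v_nz by (metis diff_zero scaleR_cancel_right scaleR_one)
    show "P x = x - f x *\<^sub>R v" for x using f[of x] by (simp add: algebra_simps)
    show "\<bar>f x\<bar> \<le> (2 + e) * norm x" for x
    proof -
      have "\<bar>f x\<bar> = norm (x - P x)" using f nv by simp
      also have "\<dots> \<le> norm x + (1 + e) * norm x"
        using norm_triangle_ineq4[of x "P x"] P(4)[of x] by linarith
      finally show ?thesis by (simp add: algebra_simps)
    qed
  qed
qed

text \<open>The hyperplane projection \<open>x - f x v\<close> is conjugated by an isometry \<open>T\<close> with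
  \<open>norm (v + T u)\<close> close to 2. Weak local uniform rotundity is used twice: at \<open>v\<close> it makes
  \<open>f (T u)\<close> close to \<open>f v = 1\<close>, and at \<open>u\<close> it makes the transported directions converge weakly
  to \<open>u\<close>.\<close>
lemma almost_projections_along_unit:
  fixes u :: "'a::real_normed_vector"
  assumes LUR: "omega_LUR TYPE('a)" and big: "big_point (b::'a)"
    and proj: "\<forall>\<epsilon>>0. \<exists>Z :: 'a set. codim1_closed_subspace Z \<and>
            (\<exists>P. is_projection_onto_with_norm P Z (1 + \<epsilon>))"
    and u: "norm u = 1"
  obtains w :: "nat \<Rightarrow> 'a" and k :: "nat \<Rightarrow> 'a \<Rightarrow> real"
  where "\<And>n. linear (k n)" "\<And>n x. \<bar>k n x\<bar> \<le> 3 * norm x" "(\<lambda>n. k n u) \<longlonglongrightarrow> 1"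
    "weakly_tendsto w u" "\<And>n x. norm (x - k n x *\<^sub>R w n) \<le> (1 + 1 / Suc n) * norm x"
proof -
  have "\<exists>w k. linear k \<and> (\<forall>x. \<bar>k x\<bar> \<le> 3 * norm x) \<and> \<bar>k u - 1\<bar> < 1 / Suc n \<and> norm w = 1
      \<and> \<bar>norm (u + w) - 2\<bar> < 1 / Suc n \<and> (\<forall>x. norm (x - k x *\<^sub>R w) \<le> (1 + 1 / Suc n) * norm x)" for n
  proof -
    define e where "e = 1 / real (Suc n)"
    have e: "e > 0" "e \<le> 1" by (auto simp: e_def)
    obtain Z P where ZP: "codim1_closed_subspace Z" "is_projection_onto_with_norm P (Z::'a set) (1 + e)"
      using proj e by blast
    obtain f v where f: "linear f" "norm v = 1" "f v = 1" "\<And>x. P x = x - f x *\<^sub>R v"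
      "\<And>x. \<bar>f x\<bar> \<le> (2 + e) * norm x"
      using projection_onto_hyperplane_form[OF ZP] by blast
    obtain T where T: "\<And>n. T n \<in> isometry_group" "(\<lambda>n. norm (v + T n u)) \<longlonglongrightarrow> 2"
      "weakly_tendsto (\<lambda>n. T n u) v"
      using omega_LUR_orbit[OF LUR big u f(2)] by blast
    have "bounded_linear f"
      using f(5) by (intro bounded_linear_intro[where K = "2 + e"])
        (auto simp: linear_add[OF f(1)] linear_scale[OF f(1)] mult.commute)
    then have "(\<lambda>n. f (T n u)) \<longlonglongrightarrow> 1"
      using T(3) f(3) by (auto simp: weakly_tendsto_def)
    then have "\<forall>\<^sub>F n in sequentially. \<bar>f (T n u) - 1\<bar> < e"
      using e by (auto simp: tendsto_iff dist_real_def)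
    moreover have "\<forall>\<^sub>F n in sequentially. \<bar>norm (v + T n u) - 2\<bar> < e"
      using T(2) e by (auto simp: tendsto_iff dist_real_def)
    ultimately have "\<forall>\<^sub>F n in sequentially. \<bar>f (T n u) - 1\<bar> < e \<and> \<bar>norm (v + T n u) - 2\<bar> < e"
      by (rule eventually_conj)
    then obtain m where m: "\<bar>f (T m u) - 1\<bar> < e" "\<bar>norm (v + T m u) - 2\<bar> < e"
      using eventually_happens'[of sequentially] by auto
    define S where "S = T m"
    have S: "S \<in> isometry_group" using T by (simp add: S_def)
    note lin = isometry_group_linear[OF S] and nrm = isometry_group_norm[OF S]
      and inv = isometry_group_inv[OF S]
    \<comment> \<open>Conjugation by \<open>S\<close> turns the kernel direction \<open>v\<close>
      into \<open>inv S v\<close>, which is as well aligned with \<open>u\<close> as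
      \<open>S u\<close> is with \<open>v\<close>.\<close>
    have "norm (u + inv S v) = norm (S (u + inv S v))" by (simp add: nrm)
    then have "norm (u + inv S v) = norm (v + S u)"
      by (simp add: linear_add[OF lin] inv add.commute)
    moreover have "norm (x - f (S x) *\<^sub>R inv S v) \<le> (1 + e) * norm x" for x
    proof -
      have "norm (x - f (S x) *\<^sub>R inv S v) = norm (S (x - f (S x) *\<^sub>R inv S v))" by (simp add: nrm)
      also have "\<dots> = norm (P (S x))"
        by (simp add: linear_diff[OF lin] linear_scale[OF lin] inv f(4))
      also have "\<dots> \<le> (1 + e) * norm (S x)"
        using ZP(2) by (auto simp: is_projection_onto_with_norm_def)
      finally show ?thesis by (simp add: nrm)
    qed
    \<comment> \<open>Because \<open>e \<le> 1\<close>, the bound becomes 3 independently of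
      \<open>n\<close>; this later confines the functionals to a compact box.\<close>
    moreover have "\<bar>f (S x)\<bar> \<le> 3 * norm x" for x
    proof -
      have "(2 + e) * norm x \<le> 3 * norm x" using e by (intro mult_right_mono) auto
      then show ?thesis using f(5)[of "S x"] by (simp add: nrm)
    qed
    moreover have "linear (\<lambda>x. f (S x))"
      using linear_compose[OF lin f(1)] by (simp add: o_def)
    moreover have "norm (inv S v) = 1"
      using isometry_group_norm[OF inv(1)] f(2) by simp
    ultimately show ?thesis
      using m unfolding S_def[symmetric] e_def[symmetric]
      by (intro exI[of _ "inv S v"] exI[of _ "\<lambda>x. f (S x)"]) auto
  qed
  then obtain w k where wk: "\<And>n. linear (k n)" "\<And>n x. \<bar>k n x\<bar> \<le> 3 * norm x"
    "\<And>n. \<bar>k n u - 1\<bar> < 1 / Suc n" "\<And>n. norm (w n) = 1"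
    "\<And>n. \<bar>norm (u + w n) - 2\<bar> < 1 / Suc n"
    "\<And>n x. norm (x - k n x *\<^sub>R w n) \<le> (1 + 1 / Suc n) * norm x"
    by metis
  have lim: "X \<longlonglongrightarrow> L" if "\<And>n. \<bar>X n - L\<bar> < 1 / Suc n" for X and L :: real
  proof -
    have "(\<lambda>n. X n - L) \<longlonglongrightarrow> 0"
      using that by (intro Lim_null_comparison[OF _ LIMSEQ_inverse_real_of_nat] always_eventually)
        (auto simp: inverse_eq_divide less_imp_le)
    then show ?thesis by (simp add: LIM_zero_iff)
  qed
  show thesis
  proof
    show "(\<lambda>n. k n u) \<longlonglongrightarrow> 1" using lim wk(3) .
    show "weakly_tendsto w u"
      using wk(4) by (intro omega_LUR_D[OF LUR u]) (auto intro: lim wk(5))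
  qed (use wk in auto)
qed

section \<open>Collineations of the real projective plane\<close>

type_synonym vec3 = "real \<times> real \<times> real"

text \<open>The cross product. Vectors stand for points of the projective plane or, as normals, for
  its lines; the product of two points is the line joining them.\<close>

definition vprod :: "vec3 \<Rightarrow> vec3 \<Rightarrow> vec3" where
  "vprod = (\<lambda>(a1, a2, a3) (b1, b2, b3). (a2 * b3 - a3 * b2, a3 * b1 - a1 * b3, a1 * b2 - a2 * b1))"

definition vdet :: "vec3 \<Rightarrow> vec3 \<Rightarrow> vec3 \<Rightarrow> real" where
  "vdet a b c = vprod a b \<bullet> c"

definition lin_comb :: "vec3 \<Rightarrow> vec3 \<Rightarrow> vec3 \<Rightarrow> vec3 \<Rightarrow> vec3" where
  "lin_comb a b c = (\<lambda>(x, y, z). x *\<^sub>R a + y *\<^sub>R b + z *\<^sub>R c)"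

lemmas vec3_simps = vprod_def vdet_def lin_comb_def inner_prod_def inner_real_def prod_eq_iff

lemma vdet_linear_dependence:
  "vdet a b (x *\<^sub>R a + y *\<^sub>R b) = 0"
  by (simp add: vec3_simps split: prod.splits) (auto simp: algebra_simps)

lemma vprod_orth: "vprod a b \<bullet> a = 0" "vprod a b \<bullet> b = 0"
  by (simp_all add: vec3_simps split: prod.splits) (simp_all add: algebra_simps)

lemma vdet_perm: "vdet a b c = vdet b c a" "vdet a b c = - vdet a c b"
  by (simp_all add: vec3_simps split: prod.splits) (simp_all add: algebra_simps)

lemma vdet_zero [simp]: "vdet 0 b c = 0" "vdet a 0 c = 0" "vdet a b 0 = 0"
  by (simp_all add: vec3_simps split: prod.splits)

lemma vprod_zero [simp]: "vprod 0 b = 0" "vprod a 0 = 0"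
  by (simp_all add: vec3_simps split: prod.splits)

lemma vprod_scale_left: "vprod (t *\<^sub>R a) b = t *\<^sub>R vprod a b"
  by (simp add: vec3_simps split: prod.splits) (simp add: algebra_simps)

lemma vprod_eq_0_imp_parallel:
  assumes "vprod a b = 0" "a \<noteq> 0"
  obtains t where "b = t *\<^sub>R a"
proof -
  obtain a1 a2 a3 b1 b2 b3 where [simp]: "a = (a1, a2, a3)" "b = (b1, b2, b3)"
    by (metis prod_cases3)
  have eq: "a2 * b3 = a3 * b2" "a3 * b1 = a1 * b3" "a1 * b2 = a2 * b1"
    using assms(1) by (auto simp: vec3_simps)
  consider "a1 \<noteq> 0" | "a2 \<noteq> 0" | "a3 \<noteq> 0" using assms(2) by (auto simp: prod_eq_iff)
  then show thesis
  proof cases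
    case 1 with eq show ?thesis by (intro that[of "b1 / a1"]) (auto simp: field_simps)
  next
    case 2 with eq show ?thesis by (intro that[of "b2 / a2"]) (auto simp: field_simps)
  next
    case 3 with eq show ?thesis by (intro that[of "b3 / a3"]) (auto simp: field_simps)
  qed
qed

text \<open>The double product \<open>vprod (vprod a b) z\<close> is a combination of
  \<open>a\<close> and \<open>b\<close> with coefficients \<open>a \<bullet> z\<close> and
  \<open>b \<bullet> z\<close> up to sign, so it vanishes.\<close>

lemma orth_two_imp_vprod:
  assumes "vprod a b \<noteq> 0" "a \<bullet> z = 0" "b \<bullet> z = 0"
  obtains t where "z = t *\<^sub>R vprod a b"
proof -
  have "vprod (vprod a b) z = (a \<bullet> z) *\<^sub>R b - (b \<bullet> z) *\<^sub>R a"
    by (simp add: vec3_simps split: prod.splits) (simp add: algebra_simps)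
  then show thesis
    using assms that vprod_eq_0_imp_parallel[of "vprod a b" z] by auto
qed

text \<open>The test vector \<open>vprod a (vprod a b)\<close> is annihilated by \<open>a\<close>,
  while its product with \<open>b\<close> is minus the squared length of
  \<open>vprod a b\<close>.\<close>

lemma annihilator_subset_imp_parallel:
  fixes a b :: vec3
  assumes "\<And>z. a \<bullet> z = 0 \<Longrightarrow> b \<bullet> z = 0" "a \<noteq> 0"
  obtains t where "b = t *\<^sub>R a"
proof -
  have "a \<bullet> vprod a (vprod a b) = 0"
    by (metis inner_commute vprod_orth(1))
  then have "b \<bullet> vprod a (vprod a b) = 0" by (rule assms(1))
  moreover have "b \<bullet> vprod a (vprod a b) = - (vprod a b \<bullet> vprod a b)"
    by (simp add: vec3_simps split: prod.splits) (simp add: algebra_simps)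
  ultimately have "vprod a b = 0" by simp
  then show thesis using assms(2) that vprod_eq_0_imp_parallel by blast
qed

lemma ex_nonzero_orth: "\<exists>f::vec3. f \<noteq> 0 \<and> f \<bullet> g = 0"
proof -
  obtain g1 g2 g3 where [simp]: "g = (g1, g2, g3)" by (metis prod_cases3)
  show ?thesis
  proof (cases "g1 = 0 \<and> g2 = 0")
    case True then show ?thesis by (intro exI[of _ "(1, 0, 0)"]) (auto simp: vec3_simps)
  next
    case False then show ?thesis by (intro exI[of _ "(g2, - g1, 0)"]) (auto simp: vec3_simps)
  qed
qed

lemma vdet_eq_0_imp_orth:
  assumes "vdet a b c = 0"
  obtains f where "f \<noteq> 0" "f \<bullet> a = 0" "f \<bullet> b = 0" "f \<bullet> c = 0"
proof -
  consider "vprod a b \<noteq> 0" | "vprod b c \<noteq> 0" | "vprod a c \<noteq> 0"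
    | "vprod a b = 0" "vprod b c = 0" "vprod a c = 0" by blast
  then show thesis
  proof cases
    case 1 then show ?thesis using assms that[of "vprod a b"] vprod_orth[of a b] by (auto simp: vdet_def)
  next
    case 2 then show ?thesis
      using assms that[of "vprod b c"] vprod_orth[of b c] vdet_perm(1)[of a b c] by (auto simp: vdet_def)
  next
    case 3 then show ?thesis
      using assms that[of "vprod a c"] vprod_orth[of a c] vdet_perm(2)[of a b c] by (auto simp: vdet_def)
  next
    case 4
    \<comment> \<open>A direction of the common line, or zero if all three vectors vanish.\<close>
    define g where "g = (if a \<noteq> 0 then a else if b \<noteq> 0 then b else c)"
    have self: "\<exists>t. x = t *\<^sub>R x" "\<exists>t. 0 = t *\<^sub>R x" for x :: vec3
      by (metis scaleR_one, metis scaleR_zero_left)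
    have par: "vprod x y = 0 \<Longrightarrow> x \<noteq> 0 \<Longrightarrow> \<exists>t. y = t *\<^sub>R x" for x y
      using vprod_eq_0_imp_parallel by metis
    have "\<exists>t. a = t *\<^sub>R g" "\<exists>t. b = t *\<^sub>R g" "\<exists>t. c = t *\<^sub>R g"
      using 4 par[of a b] par[of a c] par[of b c] self unfolding g_def by (auto split: if_splits)
    moreover obtain f where "f \<noteq> 0" "f \<bullet> g = 0" using ex_nonzero_orth by blast
    ultimately show ?thesis using that[of f] by auto
  qed
qed

lemma orth_imp_vdet_eq_0:
  assumes "z \<noteq> 0" "a \<bullet> z = 0" "b \<bullet> z = 0" "c \<bullet> z = 0"
  shows "vdet a b c = 0"
proof (cases "vprod a b = 0")
  case False
  then obtain t where t: "z = t *\<^sub>R vprod a b" using orth_two_imp_vprod assms by blast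
  then have "t * vdet a b c = 0" using assms(4) by (simp add: vdet_def inner_commute)
  then show ?thesis using t assms(1) by auto
qed (simp add: vdet_def)

text \<open>Cramer's rule.\<close>

lemma lin_comb_coordinates:
  assumes "vdet a b c \<noteq> 0"
  shows "lin_comb a b c (vdet x b c / vdet a b c, vdet a x c / vdet a b c, vdet a b x / vdet a b c) = x"
proof -
  have "vdet x b c *\<^sub>R a + vdet a x c *\<^sub>R b + vdet a b x *\<^sub>R c = vdet a b c *\<^sub>R x"
    by (simp add: vec3_simps split: prod.splits) (simp add: algebra_simps)
  then have "(vdet x b c *\<^sub>R a + vdet a x c *\<^sub>R b + vdet a b x *\<^sub>R c) /\<^sub>R vdet a b c = x"
    using assms by simp
  then show ?thesis
    by (simp add: lin_comb_def scaleR_add_right divide_inverse mult.commute)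
qed

lemma linear_lin_comb: "linear (lin_comb a b c)"
  by (rule linearI) (auto simp: lin_comb_def algebra_simps split: prod.splits)

lemma vdet_lin_comb:
  "vdet (lin_comb a b c x) (lin_comb a b c y) (lin_comb a b c z) = vdet x y z * vdet a b c"
proof -
  obtain a1 a2 a3 b1 b2 b3 c1 c2 c3 where [simp]: "a = (a1, a2, a3)" "b = (b1, b2, b3)" "c = (c1, c2, c3)"
    by (metis prod_cases3)
  obtain x1 x2 x3 y1 y2 y3 z1 z2 z3 where [simp]: "x = (x1, x2, x3)" "y = (y1, y2, y3)" "z = (z1, z2, z3)"
    by (metis prod_cases3)
  show ?thesis by (simp add: vec3_simps) algebra
qed

lemma lin_comb_inj:
  assumes "vdet a b c \<noteq> 0" "lin_comb a b c x = lin_comb a b c y"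
  shows "x = y"
proof -
  obtain x1 x2 x3 y1 y2 y3 where xy [simp]: "x = (x1, x2, x3)" "y = (y1, y2, y3)"
    by (metis prod_cases3)
  have *: "vdet (lin_comb a b c (t1, t2, t3)) b c = t1 * vdet a b c"
    "vdet a (lin_comb a b c (t1, t2, t3)) c = t2 * vdet a b c"
    "vdet a b (lin_comb a b c (t1, t2, t3)) = t3 * vdet a b c" for t1 t2 t3
    by (simp_all add: vec3_simps split: prod.splits) (simp_all add: algebra_simps)
  have "x1 * vdet a b c = y1 * vdet a b c" "x2 * vdet a b c = y2 * vdet a b c"
    "x3 * vdet a b c = y3 * vdet a b c"
    using assms(2) *[of x1 x2 x3] *[of y1 y2 y3] by auto
  then show ?thesis using assms(1) by simp
qed

text \<open>Squares go to squares, so \<open>f\<close> is monotone; since it fixes the rationals,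
  density leaves only the identity.\<close>

lemma real_ring_endomorphism_id:
  fixes f :: "real \<Rightarrow> real"
  assumes add: "\<And>x y. f (x + y) = f x + f y" and mult: "\<And>x y. f (x * y) = f x * f y" and one: "f 1 = 1"
  shows "f x = x"
proof -
  have zero: "f 0 = 0" using add[of 0 0] by simp
  have neg: "f (- x) = - f x" for x using add[of x "- x"] zero by simp
  have nat: "f (of_nat n) = of_nat n" for n by (induction n) (auto simp: add one zero)
  have int: "f (of_int n) = of_int n" for n
  proof (cases "n \<ge> 0")
    case True then show ?thesis using nat[of "nat n"] by simp
  next
    case False
    then have "(of_int n :: real) = - of_nat (nat (- n))" by simp
    then show ?thesis by (simp only: neg nat)
  qed
  have rat: "f q = q" if q: "q \<in> \<rat>" for q
  proof -
    obtain a b where ab: "b \<noteq> 0" "q = of_int a / of_int b"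
      using q by (auto simp: Rats_eq_int_div_int)
    then have "f q * of_int b = of_int a"
      using mult[of q "of_int b"] by (simp add: int)
    then have "f q = of_int a / of_int b" using ab(1) by (simp add: nonzero_eq_divide_eq)
    then show ?thesis using ab(2) by simp
  qed
  have mono: "f x \<le> f y" if "x \<le> y" for x y
  proof -
    have "f (y - x) = f (sqrt (y - x)) * f (sqrt (y - x))" using that by (simp flip: mult)
    then have "f (y - x) \<ge> 0" by simp
    then show ?thesis using add[of "y - x" x] by simp
  qed
  show ?thesis
  proof (rule ccontr)
    assume "f x \<noteq> x"
    then consider "f x < x" | "x < f x" by linarith
    then show False
    proof cases
      case 1
      then obtain q where "q \<in> \<rat>" "f x < q" "q < x" using Rats_dense_in_real by blast
      then show False using mono[of q x] rat[of q] by simp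
    next
      case 2
      then obtain q where "q \<in> \<rat>" "x < q" "q < f x" using Rats_dense_in_real by blast
      then show False using mono[of x q] rat[of q] by simp
    qed
  qed
qed

text \<open>Von Staudt's argument in the affine chart with last coordinate 1: incidences yield an
  action \<open>f\<close> on coordinates and \<open>\<phi>\<close> on slopes, and both turn out to
  be the same ring endomorphism of the reals.\<close>

lemma collineation_fixing_frame:
  fixes \<psi> :: "vec3 \<Rightarrow> vec3"
  assumes det: "\<And>a b c. a \<noteq> 0 \<Longrightarrow> b \<noteq> 0 \<Longrightarrow> c \<noteq> 0 \<Longrightarrow>
      vdet (\<psi> a) (\<psi> b) (\<psi> c) = 0 \<longleftrightarrow> vdet a b c = 0"
    and e1: "\<psi> (1, 0, 0) = (p, 0, 0)" and e2: "\<psi> (0, 1, 0) = (0, q, 0)"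
    and e3: "\<psi> (0, 0, 1) = (0, 0, r)" and e: "\<psi> (1, 1, 1) = (1, 1, 1)"
    and "u \<noteq> 0"
  shows "\<exists>t. \<psi> u = t *\<^sub>R u"
proof -
  have "vdet (\<psi> (1, 0, 0)) (\<psi> (0, 1, 0)) (\<psi> (0, 0, 1)) \<noteq> 0"
    by (subst det) (auto simp: vec3_simps)
  then have pqr: "p \<noteq> 0" "q \<noteq> 0" "r \<noteq> 0"
    by (auto simp: e1 e2 e3 vec3_simps)
  have fin: "\<psi> (x, y, 1) = (A, B, C) \<Longrightarrow> C \<noteq> 0" for x y A B C
    using det[of "(1, 0, 0)" "(0, 1, 0)" "(x, y, 1)"] pqr by (auto simp: e1 e2 vec3_simps)
  define X where "X x y = fst (\<psi> (x, y, 1)) / snd (snd (\<psi> (x, y, 1)))" for x y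
  define Y where "Y x y = fst (snd (\<psi> (x, y, 1))) / snd (snd (\<psi> (x, y, 1)))" for x y
  define f where "f x = X x 0" for x
  define g where "g y = Y 0 y" for y
  \<comment> \<open>Vertical lines are those through \<open>(0, 1, 0)\<close>, which is fixed up to
    scale, so the image abscissa depends on \<open>x\<close> alone. Horizontal lines and
    \<open>(1, 0, 0)\<close> do the same for the ordinate.\<close>
  have X: "X x y = f x" for x y
    using det[of "(0, 1, 0)" "(x, 0, 1)" "(x, y, 1)"] pqr fin[of x y] fin[of x 0]
    by (cases "\<psi> (x, y, 1)"; cases "\<psi> (x, 0, 1)") (auto simp: f_def X_def e2 vec3_simps field_simps)
  have Y: "Y x y = g y" for x y
    using det[of "(1, 0, 0)" "(0, y, 1)" "(x, y, 1)"] pqr fin[of x y] fin[of 0 y]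
    by (cases "\<psi> (x, y, 1)"; cases "\<psi> (0, y, 1)") (auto simp: g_def Y_def e1 vec3_simps field_simps)
  have affine: "\<exists>C. C \<noteq> 0 \<and> \<psi> (x, y, 1) = (C * f x, C * g y, C)" for x y
    using X[of x y] Y[of x y] fin[of x y]
    by (cases "\<psi> (x, y, 1)") (auto simp: X_def Y_def field_simps)
  have fg: "f 0 = 0" "g 0 = 0" "f 1 = 1" "g 1 = 1"
    using X[of 0 0] Y[of 0 0] X[of 1 1] Y[of 1 1] by (auto simp: X_def Y_def e3 e)
  define \<phi> where "\<phi> m = fst (snd (\<psi> (1, m, 0))) / fst (\<psi> (1, m, 0))" for m
  have infinite: "\<exists>A. A \<noteq> 0 \<and> \<psi> (1, m, 0) = (A, A * \<phi> m, 0)" for m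
    using det[of "(1, 0, 0)" "(0, 1, 0)" "(1, m, 0)"] det[of "(0, 1, 0)" "(0, 0, 1)" "(1, m, 0)"] pqr
    by (cases "\<psi> (1, m, 0)") (auto simp: \<phi>_def e1 e2 e3 vec3_simps)
  \<comment> \<open>Both points lie on a line with point at infinity \<open>(1, m, 0)\<close>; their
    images therefore lie on a line of slope \<open>\<phi> m\<close>.\<close>
  have slope: "g (y + m * s) - g y = \<phi> m * (f (x + s) - f x)" for x y m s
  proof -
    obtain C where C: "C \<noteq> 0" "\<psi> (x, y, 1) = (C * f x, C * g y, C)" using affine by blast
    obtain C' where C': "C' \<noteq> 0" "\<psi> (x + s, y + m * s, 1) = (C' * f (x + s), C' * g (y + m * s), C')"
      using affine by blast
    obtain A where A: "A \<noteq> 0" "\<psi> (1, m, 0) = (A, A * \<phi> m, 0)" using infinite by blast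
    have "vdet (\<psi> (x, y, 1)) (\<psi> (x + s, y + m * s, 1)) (\<psi> (1, m, 0)) = 0"
      by (subst det) (auto simp: vec3_simps algebra_simps)
    then have "A * C * C' * (g (y + m * s) - g y - \<phi> m * (f (x + s) - f x)) = 0"
      unfolding A(2) C(2) C'(2) vec3_simps by (simp add: algebra_simps)
    then show ?thesis using A(1) C(1) C'(1) by simp
  qed
  \<comment> \<open>Slope one through the origin identifies the two axes, slope one through other
    points of an axis gives additivity, and all lines through the origin give
    multiplicativity.\<close>
  have "\<phi> 1 = 1" using slope[of 0 1 1 0] fg by simp
  then have g: "g = f" using slope[of 0 1 _ 0] fg by auto
  have add: "f (x + y) = f x + f y" for x y
    using slope[of x 1 y 0] fg \<open>\<phi> 1 = 1\<close> by (simp add: g)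
  have \<phi>: "\<phi> m = f m" for m using slope[of 0 m 1 0] fg by (simp add: g)
  have "f (x * y) = f x * f y" for x y
    using slope[of 0 x y 0] fg by (simp add: g \<phi>)
  then have f: "f x = x" for x
    using real_ring_endomorphism_id[of f] add fg by blast
  obtain a b c where u: "u = (a, b, c)" by (metis prod_cases3)
  obtain A B C where \<psi>u: "\<psi> u = (A, B, C)" by (metis prod_cases3)
  have abc: "(a, b, c) \<noteq> 0" using \<open>u \<noteq> 0\<close> u by simp
  show ?thesis
  proof (cases "c = 0")
    case False
    obtain D where D: "D \<noteq> 0" "\<psi> (a / c, b / c, 1) = (D * (a / c), D * (b / c), D)"
      using affine[of "a / c" "b / c"] by (auto simp: f g)
    \<comment> \<open>\<open>\<psi>\<close> is not assumed homogeneous. Being parallel,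
      \<open>u\<close> and its normalised representative have determinant zero with any third
      vector; basis vectors as third vector tie \<open>\<psi> u\<close> to the known image.\<close>
    have "vdet (\<psi> u) (\<psi> (a / c, b / c, 1)) (\<psi> (1, 0, 0)) = 0"
      using False \<open>u \<noteq> 0\<close> by (subst det) (auto simp: u vec3_simps)
    then have 1: "B = C * b / c" using D pqr False by (auto simp: \<psi>u e1 vec3_simps field_simps)
    have "vdet (\<psi> u) (\<psi> (a / c, b / c, 1)) (\<psi> (0, 1, 0)) = 0"
      using False \<open>u \<noteq> 0\<close> by (subst det) (auto simp: u vec3_simps)
    then have 2: "A = C * a / c" using D pqr False by (auto simp: \<psi>u e2 vec3_simps field_simps)
    show ?thesis using 1 2 False by (intro exI[of _ "C / c"]) (auto simp: \<psi>u[unfolded u] u)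
  next
    case True
    have "vdet (\<psi> u) (\<psi> (1, 0, 0)) (\<psi> (0, 1, 0)) = 0"
      using True \<open>u \<noteq> 0\<close> by (subst det) (auto simp: u vec3_simps)
    then have C: "C = 0" using pqr by (auto simp: \<psi>u e1 e2 vec3_simps)
    show ?thesis
    proof (cases "a = 0")
      case True
      have "vdet (\<psi> u) (\<psi> (0, 0, 1)) (\<psi> (0, 1, 0)) = 0"
        using True \<open>u \<noteq> 0\<close> by (subst det) (auto simp: u vec3_simps)
      then have "A = 0" using pqr by (auto simp: \<psi>u e3 e2 vec3_simps)
      then have "\<psi> u = (B / b) *\<^sub>R u"
        unfolding \<psi>u using True \<open>c = 0\<close> abc C by (auto simp: u prod_eq_iff)
      then show ?thesis by blast
    next
      case False
      obtain D where D: "D \<noteq> 0" "\<psi> (1, b / a, 0) = (D, D * (b / a), 0)"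
        using infinite[of "b / a"] by (auto simp: \<phi> f)
      have "vdet (\<psi> u) (\<psi> (1, b / a, 0)) (\<psi> (0, 0, 1)) = 0"
        using False \<open>u \<noteq> 0\<close> by (subst det) (auto simp: u vec3_simps)
      then have "B = A * b / a" using D pqr False by (auto simp: \<psi>u e3 vec3_simps field_simps)
      then have "\<psi> u = (A / a) *\<^sub>R u"
        unfolding \<psi>u using False \<open>c = 0\<close> C by (auto simp: u)
      then show ?thesis by blast
    qed
  qed
qed

text \<open>The fundamental theorem of projective geometry for the real plane.\<close>
lemma collineation_linear:
  fixes \<phi> :: "vec3 \<Rightarrow> vec3"
  assumes det: "\<And>a b c. a \<noteq> 0 \<Longrightarrow> b \<noteq> 0 \<Longrightarrow> c \<noteq> 0 \<Longrightarrow>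
      vdet (\<phi> a) (\<phi> b) (\<phi> c) = 0 \<longleftrightarrow> vdet a b c = 0"
  obtains k1 k2 k3 where "\<And>u. u \<noteq> 0 \<Longrightarrow> \<exists>t. \<phi> u = t *\<^sub>R lin_comb k1 k2 k3 u"
proof -
  define h1 h2 h3 h where hs: "h1 = \<phi> (1, 0, 0)" "h2 = \<phi> (0, 1, 0)" "h3 = \<phi> (0, 0, 1)" "h = \<phi> (1, 1, 1)"
  have D: "vdet h1 h2 h3 \<noteq> 0" unfolding hs by (subst det) (auto simp: vec3_simps)
  define c1 c2 c3 where cs: "c1 = vdet h h2 h3 / vdet h1 h2 h3" "c2 = vdet h1 h h3 / vdet h1 h2 h3"
    "c3 = vdet h1 h2 h / vdet h1 h2 h3"
  have "vdet h h2 h3 \<noteq> 0" unfolding hs by (subst det) (auto simp: vec3_simps)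
  moreover have "vdet h1 h h3 \<noteq> 0" unfolding hs by (subst det) (auto simp: vec3_simps)
  moreover have "vdet h1 h2 h \<noteq> 0" unfolding hs by (subst det) (auto simp: vec3_simps)
  ultimately have c: "c1 \<noteq> 0" "c2 \<noteq> 0" "c3 \<noteq> 0" using D by (auto simp: cs)
  have h: "h = c1 *\<^sub>R h1 + c2 *\<^sub>R h2 + c3 *\<^sub>R h3"
    using lin_comb_coordinates[OF D, of h] by (simp add: cs lin_comb_def)
  \<comment> \<open>Scaling the columns so that they add up to \<open>h\<close> makes the matrix
    agree projectively with \<open>\<phi>\<close> on a frame of four points. The factors are nonzero
    because \<open>h\<close> lies on no line through two of \<open>h1\<close>, \<open>h2\<close>,
    \<open>h3\<close>.\<close>
  define k1 k2 k3 where ks: "k1 = c1 *\<^sub>R h1" "k2 = c2 *\<^sub>R h2" "k3 = c3 *\<^sub>R h3"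
  have "vdet k1 k2 k3 = c1 * c2 * c3 * vdet h1 h2 h3"
    unfolding ks by (simp add: vec3_simps split: prod.splits) (simp add: algebra_simps)
  then have K: "vdet k1 k2 k3 \<noteq> 0" using c D by simp
  define \<psi> where "\<psi> u = (vdet (\<phi> u) k2 k3 / vdet k1 k2 k3, vdet k1 (\<phi> u) k3 / vdet k1 k2 k3,
    vdet k1 k2 (\<phi> u) / vdet k1 k2 k3)" for u
  have \<psi>: "lin_comb k1 k2 k3 (\<psi> u) = \<phi> u" for u
    unfolding \<psi>_def by (rule lin_comb_coordinates[OF K])
  have \<psi>_eq: "\<psi> u = x" if "lin_comb k1 k2 k3 x = \<phi> u" for u x
    using lin_comb_inj[OF K] \<psi> that by metis
  have "\<exists>t. \<phi> u = t *\<^sub>R lin_comb k1 k2 k3 u" if "u \<noteq> 0" for u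
  proof -
    have "\<exists>t. \<psi> u = t *\<^sub>R u"
    proof (rule collineation_fixing_frame[where p = "1 / c1" and q = "1 / c2" and r = "1 / c3"])
      show "vdet (\<psi> a) (\<psi> b) (\<psi> c) = 0 \<longleftrightarrow> vdet a b c = 0" if "a \<noteq> 0" "b \<noteq> 0" "c \<noteq> 0" for a b c
        using vdet_lin_comb[of k1 k2 k3 "\<psi> a" "\<psi> b" "\<psi> c"] K det[OF that] by (auto simp: \<psi>)
    qed (use c h that in \<open>auto intro!: \<psi>_eq simp: lin_comb_def ks hs\<close>)
    then obtain t where "\<psi> u = t *\<^sub>R u" by blast
    moreover have "lin_comb k1 k2 k3 (t *\<^sub>R u) = t *\<^sub>R lin_comb k1 k2 k3 u"
      by (cases u) (simp add: lin_comb_def scaleR_add_right)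
    ultimately show ?thesis using \<psi>[of u] by metis
  qed
  then show thesis by (rule that)
qed

section \<open>Three-dimensional norms with flat shadow boundaries\<close>

text \<open>Along the closed curve \<open>cos t b + sin t c\<close> the derivative of \<open>ln N - ln B / 2\<close> is the
  constant \<open>B c b - B b c\<close> divided by a positive function; periodicity forces it to vanish.\<close>
lemma quadratic_of_bilinear_orthogonality:
  fixes N :: "'b::real_normed_vector \<Rightarrow> real" and B :: "'b \<Rightarrow> 'b \<Rightarrow> real"
  assumes cont: "continuous_on UNIV N" and scale: "\<And>c z. N (c *\<^sub>R z) = \<bar>c\<bar> * N z"
    and pos: "\<And>z. z \<noteq> 0 \<Longrightarrow> N z > 0"
    and bil: "bounded_bilinear B" and Bpos: "\<And>z. z \<noteq> 0 \<Longrightarrow> B z z > 0"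
    and orth: "\<And>u z. B u z = 0 \<Longrightarrow> N z \<le> N (z + u)"
    and indep: "\<And>s t. s *\<^sub>R b + t *\<^sub>R c = 0 \<Longrightarrow> s = 0 \<and> t = 0"
  shows "(N b)\<^sup>2 * B c c = (N c)\<^sup>2 * B b b"
proof -
  interpret B: bounded_bilinear B by (rule bil)
  have N0: "N 0 = 0" using scale[of 0 0] by simp
  have nonneg: "N z \<ge> 0" for z using pos[of z] N0 by (cases "z = 0") auto
  \<comment> \<open>As a function of \<open>w\<close>, the right-hand side supports \<open>N\<close>
    at \<open>z\<close>: the remainder \<open>w - \<alpha> *\<^sub>R z\<close> is
    \<open>B\<close>-orthogonal to \<open>z\<close>, so adding it cannot shorten
    \<open>\<alpha> *\<^sub>R z\<close>.\<close>
  have ineq: "N w \<ge> N z * B w z / B z z" if "z \<noteq> 0" for w z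
  proof -
    define \<alpha> where "\<alpha> = B w z / B z z"
    have \<alpha>: "B (w - \<alpha> *\<^sub>R z) z = 0"
      using Bpos[OF that] by (simp add: \<alpha>_def B.diff_left B.scaleR_left)
    have "\<bar>\<alpha>\<bar> * N z \<le> N w"
    proof (cases "\<alpha> = 0")
      case False
      have "N z \<le> N (z + (w - \<alpha> *\<^sub>R z) /\<^sub>R \<alpha>)"
        using \<alpha> by (intro orth) (simp add: B.scaleR_left)
      also have "z + (w - \<alpha> *\<^sub>R z) /\<^sub>R \<alpha> = w /\<^sub>R \<alpha>" using False by (simp add: scaleR_diff_right)
      finally show ?thesis using False by (simp add: scale field_simps)
    qed (simp add: nonneg)
    moreover have "\<alpha> * N z \<le> \<bar>\<alpha>\<bar> * N z" using nonneg by (intro mult_right_mono) auto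
    ultimately show ?thesis by (simp add: \<alpha>_def mult.commute)
  qed
  define p where "p t = cos t *\<^sub>R b + sin t *\<^sub>R c" for t
  define p' where "p' t = - sin t *\<^sub>R b + cos t *\<^sub>R c" for t
  define n where "n t = N (p t)" for t
  define q where "q t = B (p t) (p t)" for t
  have pnz: "p t \<noteq> 0" for t
    using indep[of "cos t" "sin t"] sin_zero_abs_cos_one[of t] by (auto simp: p_def)
  have n: "n t > 0" and q: "q t > 0" for t
    using pnz pos Bpos by (auto simp: n_def q_def)
  have p_deriv: "(p has_vector_derivative p' t) (at t)" for t
    unfolding p_def p'_def by (auto intro!: derivative_eq_intros)
  have p_cont: "(p \<longlongrightarrow> p t) (at t)" for t
    using has_vector_derivative_continuous[OF p_deriv] by (simp add: continuous_at isCont_def)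
  have n_cont: "(n \<longlongrightarrow> n t) (at t)" for t
    unfolding n_def using cont p_cont[of t]
    by (intro isCont_tendsto_compose[of "p t" N]) (auto simp: continuous_on_eq_continuous_at)
  have q_cont: "(q \<longlongrightarrow> q t) (at t)" for t
    unfolding q_def by (intro B.tendsto p_cont)
  have quot: "((\<lambda>s. (p s - p t) /\<^sub>R (s - t)) \<longlongrightarrow> p' t) (at t)" for t
  proof -
    have "((\<lambda>s. ((cos s - cos t) / (s - t)) *\<^sub>R b + ((sin s - sin t) / (s - t)) *\<^sub>R c) \<longlongrightarrow> p' t) (at t)"
      unfolding p'_def using DERIV_cos[of t] DERIV_sin[of t]
      by (intro tendsto_intros) (simp_all add: has_field_derivative_iff)
    moreover have "((cos s - cos t) / (s - t)) *\<^sub>R b + ((sin s - sin t) / (s - t)) *\<^sub>R c = (p s - p t) /\<^sub>R (s - t)" for s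
      by (simp add: p_def algebra_simps divide_inverse)
    ultimately show ?thesis by simp
  qed
  have n_deriv: "(n has_real_derivative n t * B (p' t) (p t) / q t) (at t)" for t
  proof -
    \<comment> \<open>The support at \<open>t\<close> bounds the difference quotient by
      \<open>L\<close>, the support at \<open>s\<close> by \<open>U\<close>. Both have the same
      limit, so \<open>N\<close> is differentiable along \<open>p\<close> although it is only
      assumed continuous.\<close>
    define d where "d s = (p s - p t) /\<^sub>R (s - t)" for s
    define L where "L s = n t * B (d s) (p t) / q t" for s
    define U where "U s = n s * B (d s) (p s) / q s" for s
    have d: "(d \<longlongrightarrow> p' t) (at t)" unfolding d_def by (rule quot)
    have L: "(L \<longlongrightarrow> n t * B (p' t) (p t) / q t) (at t)"
      unfolding L_def using q[of t] by (intro tendsto_intros B.tendsto d) auto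
    have U: "(U \<longlongrightarrow> n t * B (p' t) (p t) / q t) (at t)"
      unfolding U_def using q[of t] by (intro tendsto_intros B.tendsto d n_cont q_cont p_cont) auto
    have between: "\<bar>(n s - n t) / (s - t) - L s\<bar> \<le> \<bar>U s - L s\<bar>" if "s \<noteq> t" for s
    proof -
      have ps: "p s - p t = (s - t) *\<^sub>R d s" using that by (simp add: d_def)
      have "n s \<ge> n t * B (p s) (p t) / q t"
        using ineq[OF pnz, of t "p s"] by (simp add: n_def q_def)
      also have "B (p s) (p t) = q t + (s - t) * B (d s) (p t)"
        using arg_cong[OF ps, of "\<lambda>x. B x (p t)"] by (simp add: B.diff_left B.scaleR_left q_def)
      finally have 1: "n s - n t \<ge> (s - t) * L s"
        using q[of t] by (simp add: L_def field_simps)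
      have "n t \<ge> n s * B (p t) (p s) / q s"
        using ineq[OF pnz, of s "p t"] by (simp add: n_def q_def)
      also have "B (p t) (p s) = q s - (s - t) * B (d s) (p s)"
        using arg_cong[OF ps, of "\<lambda>x. B x (p s)"] by (simp add: B.diff_left B.scaleR_left q_def)
      finally have 2: "n s - n t \<le> (s - t) * U s"
        using q[of s] by (simp add: U_def field_simps)
      show ?thesis
      proof (cases "s > t")
        case True
        then have "L s \<le> (n s - n t) / (s - t)" "(n s - n t) / (s - t) \<le> U s"
          using 1 2 by (simp_all add: field_simps)
        then show ?thesis by linarith
      next
        case False
        then have "s < t" using that by simp
        then have "(n s - n t) / (s - t) \<le> L s" "U s \<le> (n s - n t) / (s - t)"
          using 1 2 by (simp_all add: field_simps)
        then show ?thesis by linarith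
      qed
    qed
    have "((\<lambda>s. (n s - n t) / (s - t) - L s) \<longlongrightarrow> 0) (at t)"
    proof (rule Lim_null_comparison)
      show "\<forall>\<^sub>F s in at t. norm ((n s - n t) / (s - t) - L s) \<le> \<bar>U s - L s\<bar>"
        using between by (auto simp: eventually_at_filter)
      show "((\<lambda>s. \<bar>U s - L s\<bar>) \<longlongrightarrow> 0) (at t)"
        using tendsto_rabs[OF tendsto_diff[OF U L]] by simp
    qed
    from tendsto_add[OF this L] show ?thesis
      by (simp add: has_field_derivative_iff)
  qed
  have q_deriv: "(q has_real_derivative B (p t) (p' t) + B (p' t) (p t)) (at t)" for t
    using B.has_vector_derivative[OF p_deriv p_deriv, of t]
    unfolding q_def[abs_def] has_real_derivative_iff_has_vector_derivative .
  \<comment> \<open>The skew part of \<open>B\<close> is an alternating form, and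
    \<open>p t\<close>, \<open>p' t\<close> arise from \<open>b\<close>, \<open>c\<close> by a
    rotation of coefficients; its value is thus independent of \<open>t\<close>.\<close>
  define \<kappa> where "\<kappa> = B c b - B b c"
  have \<kappa>: "B (p' t) (p t) - B (p t) (p' t) = \<kappa>" for t
  proof -
    have "B (p' t) (p t) - B (p t) (p' t) = (cos t * cos t + sin t * sin t) * \<kappa>"
      by (simp add: p_def p'_def \<kappa>_def B.add_left B.add_right B.scaleR_left B.scaleR_right B.minus_left B.minus_right
          B.diff_left B.diff_right algebra_simps del: sin_cos_squared_add3)
    then show ?thesis by simp
  qed
  define \<Phi> where "\<Phi> t = ln (n t) - ln (q t) / 2" for t
  have \<Phi>: "(\<Phi> has_real_derivative \<kappa> / (2 * q t)) (at t)" for t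
  proof -
    have "(\<Phi> has_real_derivative 1 / n t * (n t * B (p' t) (p t) / q t)
        - 1 / q t * (B (p t) (p' t) + B (p' t) (p t)) / 2) (at t)"
      unfolding \<Phi>_def[abs_def]
      by (intro DERIV_diff DERIV_cdivide DERIV_chain2[OF DERIV_ln_divide] n q n_deriv q_deriv)
    moreover have "1 / n t * (n t * B (p' t) (p t) / q t) - 1 / q t * (B (p t) (p' t) + B (p' t) (p t)) / 2
        = \<kappa> / (2 * q t)"
      using n[of t] q[of t] \<kappa>[of t] by (simp add: field_simps)
    ultimately show ?thesis by simp
  qed
  have "\<Phi> (2 * pi) - \<Phi> 0 = 0" by (simp add: \<Phi>_def n_def q_def p_def)
  moreover obtain \<xi> where "\<Phi> (2 * pi) - \<Phi> 0 = (2 * pi - 0) * (\<kappa> / (2 * q \<xi>))"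
    using MVT2[of 0 "2 * pi" \<Phi> "\<lambda>t. \<kappa> / (2 * q t)"] \<Phi> by auto
  ultimately have "\<kappa> = 0" using q[of \<xi>] by auto
  \<comment> \<open>At parameters 0 and \<open>pi / 2\<close> the curve passes through
    \<open>b\<close> and \<open>c\<close>.\<close>
  then have "\<Phi> 0 = \<Phi> (pi / 2)"
    using \<Phi> by (intro DERIV_isconst_all) auto
  then have "ln (N b) - ln (B b b) / 2 = ln (N c) - ln (B c c) / 2"
    by (simp add: \<Phi>_def n_def q_def p_def)
  moreover have bc: "b \<noteq> 0" "c \<noteq> 0" using indep[of 1 0] indep[of 0 1] by auto
  moreover have gt: "N b > 0" "N c > 0" "B b b > 0" "B c c > 0" using bc pos Bpos by auto
  ultimately have "ln ((N b)\<^sup>2 * B c c) = ln ((N c)\<^sup>2 * B b b)"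
    by (simp add: ln_mult_pos ln_realpow)
  then show ?thesis using gt by (subst (asm) ln_inj_iff) auto
qed

text \<open>The last assumption makes every direction \<open>u\<close> the kernel of a norm-one
  projection. Geometrically, the points at which lines in direction \<open>u\<close> graze the ball
  fill its section with the plane normal to \<open>h\<close>.\<close>

locale flat_shadow_norm =
  fixes N :: "vec3 \<Rightarrow> real"
  assumes cont: "continuous_on UNIV N" and scale: "N (c *\<^sub>R z) = \<bar>c\<bar> * N z"
    and pos: "z \<noteq> 0 \<Longrightarrow> N z > 0"
    and strict: "N z = N w \<Longrightarrow> N (z + w) \<ge> N z + N w \<Longrightarrow> z = w"
    and contraction: "u \<noteq> 0 \<Longrightarrow> \<exists>h. h \<bullet> u = 1 \<and> (\<forall>z. N (z - (h \<bullet> z) *\<^sub>R u) \<le> N z)"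
begin

definition birkhoff_orth :: "vec3 \<Rightarrow> vec3 \<Rightarrow> bool" where
  "birkhoff_orth z u \<longleftrightarrow> (\<forall>t. N z \<le> N (z + t *\<^sub>R u))"

text \<open>The choice is harmless: the orthogonality relation to \<open>u\<close> determines the
  plane, and the product 1 with \<open>u\<close> the scale.\<close>

definition conormal :: "vec3 \<Rightarrow> vec3" where
  "conormal u = (SOME h. h \<bullet> u = 1 \<and> (\<forall>z. N (z - (h \<bullet> z) *\<^sub>R u) \<le> N z))"

lemma conormal_self: "u \<noteq> 0 \<Longrightarrow> conormal u \<bullet> u = 1"
  and conormal_contraction: "u \<noteq> 0 \<Longrightarrow> N (z - (conormal u \<bullet> z) *\<^sub>R u) \<le> N z"
  using someI_ex[OF contraction, of u] unfolding conormal_def by blast+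

lemma conormal_nonzero: "u \<noteq> 0 \<Longrightarrow> conormal u \<noteq> 0"
  using conormal_self[of u] by auto

text \<open>If \<open>z\<close> is orthogonal to \<open>u\<close>, then \<open>z\<close> and its
  projection \<open>w\<close> have equal norm and their midpoint is no shorter; strict convexity
  gives \<open>z = w\<close>.\<close>

lemma birkhoff_orth_iff:
  assumes "u \<noteq> 0"
  shows "birkhoff_orth z u \<longleftrightarrow> conormal u \<bullet> z = 0"
proof
  assume orth: "birkhoff_orth z u"
  define w where "w = z - (conormal u \<bullet> z) *\<^sub>R u"
  have "N w \<le> N z" using conormal_contraction[OF assms] by (simp add: w_def)
  moreover have "N z \<le> N w"
    using orth[unfolded birkhoff_orth_def, rule_format, of "- (conormal u \<bullet> z)"] by (simp add: w_def)
  ultimately have eq: "N z = N w" by simp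
  have "N z \<le> N (z + (- (conormal u \<bullet> z) / 2) *\<^sub>R u)"
    using orth[unfolded birkhoff_orth_def, rule_format, of "- (conormal u \<bullet> z) / 2"] .
  also have "z + (- (conormal u \<bullet> z) / 2) *\<^sub>R u = (1 / 2) *\<^sub>R (z + w)"
  proof -
    have "(1 / 2) *\<^sub>R (z + z) = z" by (simp flip: scaleR_2)
    then show ?thesis by (simp add: w_def algebra_simps)
  qed
  finally have "N z + N w \<le> N (z + w)" by (simp add: scale eq)
  then have "z = w" using strict eq by blast
  then show "conormal u \<bullet> z = 0" using assms by (simp add: w_def)
next
  assume "conormal u \<bullet> z = 0"
  then have "z + t *\<^sub>R u - (conormal u \<bullet> (z + t *\<^sub>R u)) *\<^sub>R u = z" for t
    by (simp add: inner_add_right conormal_self[OF assms])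
  then show "birkhoff_orth z u"
    using conormal_contraction[OF assms] unfolding birkhoff_orth_def by metis
qed

lemma not_birkhoff_orth_self: "u \<noteq> 0 \<Longrightarrow> \<not> birkhoff_orth u u"
  by (simp add: birkhoff_orth_iff conormal_self)

lemma birkhoff_orth_scale_right: "c \<noteq> 0 \<Longrightarrow> birkhoff_orth z (c *\<^sub>R u) \<longleftrightarrow> birkhoff_orth z u"
proof -
  assume c: "c \<noteq> 0"
  have "(\<forall>t. P (t * c)) \<longleftrightarrow> (\<forall>t. P t)" for P :: "real \<Rightarrow> bool"
    using c by (metis nonzero_divide_eq_eq)
  from this[of "\<lambda>t. N z \<le> N (z + t *\<^sub>R u)"] show ?thesis by (simp add: birkhoff_orth_def)
qed

text \<open>Stands in for continuity of \<open>conormal\<close>: limits of directions are taken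
  inside the relation.\<close>

lemma birkhoff_orth_closed:
  assumes "\<And>n. birkhoff_orth z (U n)" "U \<longlonglongrightarrow> u"
  shows "birkhoff_orth z u"
  unfolding birkhoff_orth_def
proof
  fix t
  have "(\<lambda>n. z + t *\<^sub>R U n) \<longlonglongrightarrow> z + t *\<^sub>R u" using assms(2) by (intro tendsto_intros)
  then have "(\<lambda>n. N (z + t *\<^sub>R U n)) \<longlonglongrightarrow> N (z + t *\<^sub>R u)"
    by (rule continuous_on_tendsto_compose[OF cont]) simp_all
  then show "N z \<le> N (z + t *\<^sub>R u)"
    using assms(1) by (intro LIMSEQ_le_const) (auto simp: birkhoff_orth_def)
qed

text \<open>Where \<open>f\<close> divided by \<open>N\<close> is maximal, the ball is supported by
  a plane parallel to the kernel of \<open>f\<close>. The quotient is scale invariant, so the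
  compact Euclidean sphere can be used.\<close>

lemma ex_birkhoff_orth_plane:
  assumes "f \<noteq> 0"
  obtains w where "w \<noteq> 0" "\<And>u. f \<bullet> u = 0 \<Longrightarrow> birkhoff_orth w u"
proof -
  have "continuous_on (sphere 0 1) (\<lambda>z. (f \<bullet> z) / N z)"
  proof (intro continuous_intros)
    show "continuous_on (sphere 0 1) N" using cont continuous_on_subset by blast
    show "\<forall>z\<in>sphere 0 1. N z \<noteq> 0"
    proof
      fix z :: vec3 assume "z \<in> sphere 0 1"
      then have "z \<noteq> 0" by auto
      then show "N z \<noteq> 0" using pos[of z] by simp
    qed
  qed
  moreover have "f /\<^sub>R norm f \<in> sphere 0 1" using assms by simp
  ultimately obtain w where w: "w \<in> sphere 0 1" "\<And>z. z \<in> sphere 0 1 \<Longrightarrow> (f \<bullet> z) / N z \<le> (f \<bullet> w) / N w"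
    using continuous_attains_sup[OF compact_sphere, of "0::vec3" 1 "\<lambda>z. (f \<bullet> z) / N z"] by blast
  have wnz: "w \<noteq> 0" using w(1) by auto
  have max: "(f \<bullet> z) / N z \<le> (f \<bullet> w) / N w" if "z \<noteq> 0" for z
    using w(2)[of "z /\<^sub>R norm z"] that by (simp add: scale)
  have "0 < (f \<bullet> f) / N f" using assms pos by simp
  then have "(f \<bullet> w) / N w > 0" using max[OF assms] by linarith
  then have fw: "f \<bullet> w > 0" using pos[OF wnz] by (simp add: zero_less_divide_iff)
  have "birkhoff_orth w u" if "f \<bullet> u = 0" for u
    unfolding birkhoff_orth_def
  proof
    fix t
    have "f \<bullet> (w + t *\<^sub>R u) = f \<bullet> w" using that by (simp add: inner_add_right)
    moreover have "w + t *\<^sub>R u \<noteq> 0" using calculation fw by auto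
    ultimately have "(f \<bullet> w) / N (w + t *\<^sub>R u) \<le> (f \<bullet> w) / N w" using max[of "w + t *\<^sub>R u"] by simp
    then show "N w \<le> N (w + t *\<^sub>R u)"
      using fw pos[OF wnz] pos[OF \<open>w + t *\<^sub>R u \<noteq> 0\<close>] by (simp add: field_simps)
  qed
  then show thesis using that wnz by blast
qed

text \<open>The contact direction \<open>w\<close> of a plane containing all three vectors is
  orthogonal to each of them, so the three conormals annihilate \<open>w\<close> together.\<close>

lemma conormal_coplanar:
  assumes "a \<noteq> 0" "b \<noteq> 0" "c \<noteq> 0" "vdet a b c = 0"
  shows "vdet (conormal a) (conormal b) (conormal c) = 0"
proof -
  obtain f where "f \<noteq> 0" "f \<bullet> a = 0" "f \<bullet> b = 0" "f \<bullet> c = 0"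
    using vdet_eq_0_imp_orth[OF assms(4)] .
  moreover then obtain w where "w \<noteq> 0" "\<And>u. f \<bullet> u = 0 \<Longrightarrow> birkhoff_orth w u"
    using ex_birkhoff_orth_plane by blast
  ultimately show ?thesis
    using assms by (intro orth_imp_vdet_eq_0[of w]) (auto simp flip: birkhoff_orth_iff)
qed

text \<open>If the planes orthogonal to \<open>u\<close> and \<open>u'\<close> agree, let \<open>w\<close> be orthogonal to the span of
  \<open>u\<close> and \<open>u'\<close>. Projecting the plane of \<open>u, w\<close> onto that of \<open>u', w\<close> from two different points
  of the span shows that the plane belonging to \<open>u' + y w\<close> is unchanged when \<open>y\<close> is divided by
  some \<open>t > 1\<close>. Iterating in both directions identifies the planes of \<open>u'\<close> and \<open>w\<close>, although
  \<open>w\<close> lies in the first and not in the second.\<close>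
lemma conormal_nonparallel:
  assumes "vprod u u' \<noteq> 0"
  shows "vprod (conormal u) (conormal u') \<noteq> 0"
proof
  assume par: "vprod (conormal u) (conormal u') = 0"
  have nz: "u \<noteq> 0" "u' \<noteq> 0" using assms by auto
  define f where "f = vprod u u'"
  obtain \<tau> where \<tau>: "conormal u' = \<tau> *\<^sub>R conormal u"
    using vprod_eq_0_imp_parallel[OF par conormal_nonzero[OF nz(1)]] .
  have \<tau>0: "\<tau> \<noteq> 0" using \<tau> conormal_nonzero[OF nz(2)] by auto
  obtain w where w: "w \<noteq> 0" and orth: "\<And>x. f \<bullet> x = 0 \<Longrightarrow> birkhoff_orth w x"
    using ex_birkhoff_orth_plane[of f] assms f_def by blast
  have fu: "f \<bullet> u = 0" "f \<bullet> u' = 0" by (simp_all add: f_def vprod_orth)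
  have fw: "f \<bullet> w \<noteq> 0" using orth not_birkhoff_orth_self[OF w] by blast
  have hw: "conormal u \<bullet> w = 0" "conormal u' \<bullet> w = 0"
    using orth fu nz by (simp_all flip: birkhoff_orth_iff)
  have hww: "conormal w \<bullet> w = 1" using conormal_self[OF w] .
  define \<alpha> where "\<alpha> = conormal u \<bullet> u'"
  have \<alpha>: "\<alpha> \<noteq> 0" using conormal_self[OF nz(2)] \<tau> by (auto simp: \<alpha>_def)
  \<comment> \<open>Centres of perspectivity: \<open>s t\<close> is \<open>\<alpha>\<close> times
    the difference of \<open>u + x *\<^sub>R w\<close> and
    \<open>(t / \<alpha>) *\<^sub>R u' + x *\<^sub>R w\<close>, whatever \<open>x\<close> is. The
    factor \<open>\<alpha>\<close> puts \<open>s 1\<close> into the common plane of \<open>u\<close>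
    and \<open>u'\<close>.\<close>
  define s where "s t = \<alpha> *\<^sub>R u - t *\<^sub>R u'" for t
  have snz: "s t \<noteq> 0" for t
  proof
    assume "s t = 0"
    then have "vprod (\<alpha> *\<^sub>R u) u' = vprod (t *\<^sub>R u') u'" by (simp add: s_def)
    then have "\<alpha> *\<^sub>R vprod u u' = t *\<^sub>R vprod u' u'" by (simp only: vprod_scale_left)
    moreover have "vprod u' u' = 0" by (simp add: vec3_simps split: prod.splits)
    ultimately show False using \<alpha> assms by simp
  qed
  have fs: "f \<bullet> s t = 0" for t by (simp add: s_def fu inner_diff_right)
  \<comment> \<open>As the conormals of \<open>u\<close> and \<open>u'\<close> are parallel,
    \<open>k\<close> is orthogonal to the conormals of all nonzero vectors in the span of
    \<open>u, w\<close> and in that of \<open>u', w\<close>.\<close>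
  define k where "k = vprod (conormal u) (conormal w)"
  have knz: "k \<noteq> 0"
  proof
    assume "k = 0"
    then obtain r where "conormal w = r *\<^sub>R conormal u"
      unfolding k_def using vprod_eq_0_imp_parallel conormal_nonzero[OF nz(1)] by metis
    then show False using hw hww by simp
  qed
  have kw: "vprod k w \<noteq> 0"
  proof
    assume "vprod k w = 0"
    then obtain r where "w = r *\<^sub>R k" using vprod_eq_0_imp_parallel knz by metis
    then have "conormal w \<bullet> w = r * (conormal w \<bullet> k)" by (metis inner_scaleR_right)
    also have "conormal w \<bullet> k = 0" unfolding k_def by (metis inner_commute vprod_orth(2))
    finally show False using hww by simp
  qed
  \<comment> \<open>Were the two conormals not parallel, that of \<open>s t\<close> would be
    orthogonal to both \<open>k\<close> and \<open>w\<close>, hence parallel to that of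
    \<open>u\<close>; the witness \<open>y\<close> excludes this.\<close>
  have step: "birkhoff_orth z (u + x *\<^sub>R w) \<longleftrightarrow> birkhoff_orth z ((t / \<alpha>) *\<^sub>R u' + x *\<^sub>R w)"
    if y: "conormal u \<bullet> y = 0" "conormal (s t) \<bullet> y \<noteq> 0" and x: "x \<noteq> 0" for x y z t
  proof -
    define v v' where vs: "v = u + x *\<^sub>R w" "v' = (t / \<alpha>) *\<^sub>R u' + x *\<^sub>R w"
    have "f \<bullet> v \<noteq> 0" "f \<bullet> v' \<noteq> 0" using fw x by (simp_all add: vs inner_add_right fu)
    then have vnz: "v \<noteq> 0" "v' \<noteq> 0" by auto
    have "vdet u w v = 0" using vdet_linear_dependence[of u w 1 x] by (simp add: vs)
    then have kv: "k \<bullet> conormal v = 0"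
      using conormal_coplanar[OF nz(1) w vnz(1)] by (simp add: vdet_def k_def)
    have "vdet u' w v' = 0" using vdet_linear_dependence[of u' w "t / \<alpha>" x] by (simp add: vs)
    then have "vdet (conormal u') (conormal w) (conormal v') = 0"
      using conormal_coplanar[OF nz(2) w vnz(2)] by simp
    then have kv': "k \<bullet> conormal v' = 0"
      using \<tau>0 by (simp add: vdet_def k_def \<tau> vprod_scale_left)
    have "s t = \<alpha> *\<^sub>R v + (- \<alpha>) *\<^sub>R v'" using \<alpha> by (simp add: vs s_def scaleR_add_right)
    then have "vdet v v' (s t) = 0" using vdet_linear_dependence[of v v' \<alpha> "- \<alpha>"] by simp
    then have vs': "vdet (conormal v) (conormal v') (conormal (s t)) = 0"
      using conormal_coplanar[OF vnz snz] by simp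
    have par_v: "vprod (conormal v) (conormal v') = 0"
    proof (rule ccontr)
      assume n: "vprod (conormal v) (conormal v') \<noteq> 0"
      obtain r where "k = r *\<^sub>R vprod (conormal v) (conormal v')"
        using orth_two_imp_vprod[OF n, of k] kv kv' by (metis inner_commute)
      then have ks: "k \<bullet> conormal (s t) = 0" using vs' by (simp add: vdet_def)
      have ws: "w \<bullet> conormal (s t) = 0"
        using orth[OF fs] birkhoff_orth_iff[OF snz] by (metis inner_commute)
      have ku: "k \<bullet> conormal u = 0" unfolding k_def by (rule vprod_orth)
      have wu: "w \<bullet> conormal u = 0" using hw by (metis inner_commute)
      obtain r1 where r1: "conormal (s t) = r1 *\<^sub>R vprod k w" using orth_two_imp_vprod[OF kw ks ws] .
      obtain r2 where r2: "conormal u = r2 *\<^sub>R vprod k w" using orth_two_imp_vprod[OF kw ku wu] .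
      have "r2 \<noteq> 0" using r2 conormal_nonzero[OF nz(1)] by auto
      then have "vprod k w \<bullet> y = 0" using y(1) r2 by simp
      then show False using y(2) r1 by simp
    qed
    obtain r where r: "conormal v' = r *\<^sub>R conormal v"
      using vprod_eq_0_imp_parallel[OF par_v conormal_nonzero[OF vnz(1)]] .
    have "r \<noteq> 0" using r conormal_nonzero[OF vnz(2)] by auto
    then show ?thesis unfolding vs[symmetric] birkhoff_orth_iff[OF vnz(1)] birkhoff_orth_iff[OF vnz(2)] r by simp
  qed
  have hs: "conormal u \<bullet> s 1 = 0" by (simp add: s_def inner_diff_right conormal_self[OF nz(1)] \<alpha>_def)
  \<comment> \<open>Otherwise \<open>s 1\<close> is orthogonal to vectors tending to
    \<open>s 1\<close>, hence to itself. For the resulting \<open>t\<close>, the vector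
    \<open>s 1\<close> is a witness in \<open>step\<close>.\<close>
  have "\<exists>n. conormal (s (1 + 1 / Suc n)) \<bullet> s 1 \<noteq> 0"
  proof (rule ccontr)
    assume "\<not> ?thesis"
    then have "birkhoff_orth (s 1) (s (1 + 1 / Suc n))" for n
      by (simp add: birkhoff_orth_iff[OF snz])
    moreover have "(\<lambda>n. s (1 + 1 / Suc n)) \<longlonglongrightarrow> s (1 + 0)"
      unfolding s_def using LIMSEQ_inverse_real_of_nat
      by (intro tendsto_intros) (simp add: inverse_eq_divide)
    ultimately have "birkhoff_orth (s 1) (s (1 + 0))" by (rule birkhoff_orth_closed)
    then show False using not_birkhoff_orth_self[OF snz] by simp
  qed
  then obtain t where t: "t > 1" "conormal (s t) \<bullet> s 1 \<noteq> 0"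
    by (metis less_add_same_cancel1 of_nat_0_less_iff zero_less_Suc zero_less_divide_1_iff)
  \<comment> \<open>Pass to \<open>u + (y / \<alpha>) *\<^sub>R w\<close> with centre
    \<open>s 1\<close> and return with centre \<open>s t\<close>; the round trip divides
    \<open>y\<close> by \<open>t\<close>.\<close>
  have contract: "birkhoff_orth z (u' + y *\<^sub>R w) \<longleftrightarrow> birkhoff_orth z (u' + (y / t) *\<^sub>R w)"
    if "y \<noteq> 0" for y z
  proof -
    have "birkhoff_orth z ((1 / \<alpha>) *\<^sub>R (u' + y *\<^sub>R w)) \<longleftrightarrow> birkhoff_orth z (u + (y / \<alpha>) *\<^sub>R w)"
      using step[OF hs, of 1 "y / \<alpha>" z] that \<alpha> conormal_self[OF snz] by (simp add: scaleR_add_right)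
    also have "\<dots> \<longleftrightarrow> birkhoff_orth z ((t / \<alpha>) *\<^sub>R (u' + (y / t) *\<^sub>R w))"
      using step[OF hs t(2), of "y / \<alpha>" z] that \<alpha> t(1) by (simp add: scaleR_add_right)
    also have "\<dots> \<longleftrightarrow> birkhoff_orth z (u' + (y / t) *\<^sub>R w)"
      by (rule birkhoff_orth_scale_right) (use \<alpha> t(1) in simp)
    also have "birkhoff_orth z ((1 / \<alpha>) *\<^sub>R (u' + y *\<^sub>R w)) \<longleftrightarrow> birkhoff_orth z (u' + y *\<^sub>R w)"
      by (rule birkhoff_orth_scale_right) (use \<alpha> in simp)
    finally show ?thesis .
  qed
  have shrink: "birkhoff_orth z (u' + w) \<longleftrightarrow> birkhoff_orth z (u' + (1 / t ^ n) *\<^sub>R w)" for z n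
  proof (induction n)
    case (Suc n)
    then show ?case using contract[of "1 / t ^ n" z] t(1) by (simp add: mult.commute)
  qed simp
  have grow: "birkhoff_orth z (u' + w) \<longleftrightarrow> birkhoff_orth z (u' + t ^ n *\<^sub>R w)" for z n
  proof (induction n)
    case (Suc n)
    then show ?case using contract[of "t ^ Suc n" z] t(1) by simp
  qed simp
  have lim: "(\<lambda>n. 1 / t ^ n) \<longlonglongrightarrow> 0"
    using t(1) LIMSEQ_power_zero[of "1 / t"] by (simp add: power_one_over)
  have "u' + w \<noteq> 0"
  proof
    assume "u' + w = 0"
    then have "f \<bullet> (u' + w) = 0" by simp
    then show False using fu fw by (simp add: inner_add_right)
  qed
  have "birkhoff_orth z u'" if "birkhoff_orth z (u' + w)" for z
  proof -
    have "(\<lambda>n. u' + (1 / t ^ n) *\<^sub>R w) \<longlonglongrightarrow> u' + 0 *\<^sub>R w" by (intro tendsto_intros lim)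
    then show ?thesis using birkhoff_orth_closed[of z "\<lambda>n. u' + (1 / t ^ n) *\<^sub>R w"] shrink that by simp
  qed
  then obtain r where r: "conormal u' = r *\<^sub>R conormal (u' + w)"
    using annihilator_subset_imp_parallel[of "conormal (u' + w)" "conormal u'"]
      conormal_nonzero \<open>u' + w \<noteq> 0\<close> nz by (metis birkhoff_orth_iff)
  then have "r \<noteq> 0" using conormal_nonzero[OF nz(2)] by auto
  then have "birkhoff_orth w (u' + w)"
    using hw(2) r birkhoff_orth_iff[OF \<open>u' + w \<noteq> 0\<close>] by simp
  then have "birkhoff_orth w (u' + t ^ n *\<^sub>R w)" for n using grow by blast
  then have "birkhoff_orth w ((1 / t ^ n) *\<^sub>R (u' + t ^ n *\<^sub>R w))" for n
    using t(1) by (subst birkhoff_orth_scale_right) auto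
  then have "birkhoff_orth w ((1 / t ^ n) *\<^sub>R u' + w)" for n
    using t(1) by (simp add: scaleR_add_right)
  moreover have "(\<lambda>n. (1 / t ^ n) *\<^sub>R u' + w) \<longlonglongrightarrow> 0 *\<^sub>R u' + w" by (intro tendsto_intros lim)
  ultimately have "birkhoff_orth w (0 *\<^sub>R u' + w)" by (rule birkhoff_orth_closed)
  then show False using not_birkhoff_orth_self[OF w] by simp
qed

text \<open>A vector \<open>z\<close> annihilated by all three conormals is a multiple of the
  contact direction of the plane of \<open>a\<close>, \<open>b\<close>, hence annihilated by every
  conormal of that plane. Splitting \<open>z\<close> into a vector \<open>p\<close> of this plane
  and a multiple of \<open>c\<close>, the conormals of \<open>p\<close> and \<open>c\<close>
  annihilate \<open>z\<close>; by coplanarity so does that of \<open>z\<close> itself, which is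
  absurd.\<close>

lemma conormal_independent:
  assumes "vdet a b c \<noteq> 0"
  shows "vdet (conormal a) (conormal b) (conormal c) \<noteq> 0"
proof
  assume "vdet (conormal a) (conormal b) (conormal c) = 0"
  then obtain z where z: "z \<noteq> 0" "z \<bullet> conormal a = 0" "z \<bullet> conormal b = 0" "z \<bullet> conormal c = 0"
    using vdet_eq_0_imp_orth by metis
  note z' = z(2-4)[unfolded inner_commute[of z]]
  have nz: "a \<noteq> 0" "b \<noteq> 0" "c \<noteq> 0" using assms by auto
  define f where "f = vprod a b"
  have fnz: "f \<noteq> 0" and fc: "f \<bullet> c \<noteq> 0" using assms by (auto simp: vdet_def f_def)
  obtain w where w: "w \<noteq> 0" and orth: "\<And>x. f \<bullet> x = 0 \<Longrightarrow> birkhoff_orth w x"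
    using ex_birkhoff_orth_plane[OF fnz] by blast
  have fab: "f \<bullet> a = 0" "f \<bullet> b = 0" by (simp_all add: f_def vprod_orth)
  have np: "vprod (conormal a) (conormal b) \<noteq> 0" using conormal_nonparallel fnz f_def by blast
  have "conormal a \<bullet> w = 0" "conormal b \<bullet> w = 0"
    using orth fab nz by (simp_all flip: birkhoff_orth_iff)
  then obtain r1 where r1: "w = r1 *\<^sub>R vprod (conormal a) (conormal b)"
    using orth_two_imp_vprod[OF np] by blast
  obtain r2 where r2: "z = r2 *\<^sub>R vprod (conormal a) (conormal b)"
    using orth_two_imp_vprod[OF np z'(1,2)] .
  have "r1 \<noteq> 0" using r1 w by auto
  have plane: "conormal x \<bullet> z = 0" if "f \<bullet> x = 0" "x \<noteq> 0" for x
  proof -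
    have "conormal x \<bullet> w = 0" using orth that by (simp flip: birkhoff_orth_iff)
    then show ?thesis using \<open>r1 \<noteq> 0\<close> by (simp add: r1 r2)
  qed
  obtain \<alpha> \<beta> \<gamma> where zc: "z = \<alpha> *\<^sub>R a + \<beta> *\<^sub>R b + \<gamma> *\<^sub>R c"
    using lin_comb_coordinates[OF assms, of z, symmetric] unfolding lin_comb_def prod.case by blast
  define p where "p = \<alpha> *\<^sub>R a + \<beta> *\<^sub>R b"
  have fp: "f \<bullet> p = 0" by (simp add: p_def inner_add_right fab)
  have zp: "z = p + \<gamma> *\<^sub>R c" by (simp add: zc p_def)
  have "\<gamma> \<noteq> 0" using plane[of z] fp conormal_self[OF z(1)] z(1) by (auto simp: zp)
  have "p \<noteq> 0" using z'(3) conormal_self[OF nz(3)] \<open>\<gamma> \<noteq> 0\<close> by (auto simp: zp)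
  have "vprod p c \<noteq> 0"
  proof
    assume "vprod p c = 0"
    then obtain r where "c = r *\<^sub>R p" using vprod_eq_0_imp_parallel \<open>p \<noteq> 0\<close> by metis
    then show False using fp fc by simp
  qed
  then have np': "vprod (conormal p) (conormal c) \<noteq> 0" by (rule conormal_nonparallel)
  obtain r where r: "z = r *\<^sub>R vprod (conormal p) (conormal c)"
    using orth_two_imp_vprod[OF np' plane[OF fp \<open>p \<noteq> 0\<close>] z'(3)] .
  have "vdet p c z = 0" using vdet_linear_dependence[of p c 1 \<gamma>] by (simp add: zp)
  then have "vdet (conormal p) (conormal c) (conormal z) = 0"
    using conormal_coplanar \<open>p \<noteq> 0\<close> nz(3) z(1) by blast
  then have "z \<bullet> conormal z = 0" by (subst r) (simp add: vdet_def)
  then show False using conormal_self[OF z(1)] by (simp add: inner_commute)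
qed

text \<open>The matrix of the collineation \<open>conormal\<close> gives \<open>B\<close> up to
  sign. No nonzero vector is orthogonal to itself, so \<open>B z z\<close> has no zero on the
  connected punctured space, and one sign \<open>\<sigma>\<close> makes it positive throughout.
  Symmetry is not asserted here.\<close>

lemma ex_bilinear_orth:
  obtains B :: "vec3 \<Rightarrow> vec3 \<Rightarrow> real"
  where "bounded_bilinear B" "\<And>z. z \<noteq> 0 \<Longrightarrow> B z z > 0" "\<And>u z. B u z = 0 \<Longrightarrow> N z \<le> N (z + u)"
proof -
  obtain k1 k2 k3 where k: "\<And>u. u \<noteq> 0 \<Longrightarrow> \<exists>t. conormal u = t *\<^sub>R lin_comb k1 k2 k3 u"
    using collineation_linear[of conormal] conormal_coplanar conormal_independent by metis
  define B where "B \<sigma> u z = \<sigma> * (lin_comb k1 k2 k3 u \<bullet> z)" for \<sigma> u z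
  have "bilinear (B \<sigma>)" for \<sigma>
    unfolding bilinear_def
  proof (intro conjI allI)
    show "linear (B \<sigma> u)" for u
      by (rule linearI) (simp_all add: B_def inner_add_right distrib_left)
    show "linear (\<lambda>u. B \<sigma> u z)" for z
      by (rule linearI) (simp_all add: B_def linear_add[OF linear_lin_comb] linear_scale[OF linear_lin_comb]
          inner_add_left distrib_left)
  qed
  then have bil: "bounded_bilinear (B \<sigma>)" for \<sigma> by (simp add: bilinear_conv_bounded_bilinear)
  have nz: "B 1 z z \<noteq> 0" if z: "z \<noteq> 0" for z
  proof -
    obtain t where "conormal z = t *\<^sub>R lin_comb k1 k2 k3 z" using k[OF z] ..
    then have "1 = t * B 1 z z" using conormal_self[OF z] by (simp add: B_def)
    then show ?thesis by auto
  qed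
  have orth: "N z \<le> N (z + u)" if "B \<sigma> u z = 0" "\<sigma> \<noteq> 0" for \<sigma> u z
  proof (cases "u = 0")
    case False
    then obtain t where "conormal u = t *\<^sub>R lin_comb k1 k2 k3 u" using k by blast
    then have "conormal u \<bullet> z = 0" using that by (simp add: B_def)
    then have "birkhoff_orth z u" using birkhoff_orth_iff[OF False] by simp
    then show ?thesis unfolding birkhoff_orth_def by (metis scaleR_one)
  qed simp
  have conn: "connected ((\<lambda>z. B 1 z z) ` (- {0}))"
    by (intro connected_continuous_image connected_punctured_universe
        bounded_bilinear.continuous_on[OF bil] continuous_on_id) simp_all
  have sgn: "B 1 x x > 0" if "B 1 y y > 0" "y \<noteq> 0" "x \<noteq> 0" for x y
  proof (rule ccontr)
    assume "\<not> B 1 x x > 0"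
    then have "B 1 x x \<le> 0" "0 \<le> B 1 y y" using that(1) by simp_all
    moreover have "B 1 x x \<in> (\<lambda>z. B 1 z z) ` (- {0})" "B 1 y y \<in> (\<lambda>z. B 1 z z) ` (- {0})"
      using that(2,3) by blast+
    ultimately have "0 \<in> (\<lambda>z. B 1 z z) ` (- {0})"
      using connectedD_interval[OF conn] by blast
    then obtain z where "0 = B 1 z z" "z \<in> - {0}" by (rule imageE)
    then show False using nz[of z] by simp
  qed
  define e :: vec3 where "e = (1, 0, 0)"
  have e: "e \<noteq> 0" by (simp add: e_def prod_eq_iff)
  show thesis
  proof (cases "B 1 e e > 0")
    case True
    show ?thesis
      by (rule that[OF bil[of 1]]) (use True sgn e orth[of 1] in auto)
  next
    case False
    have "B 1 x x < 0" if "x \<noteq> 0" for x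
      using sgn[of x e] nz[OF that] nz[OF e] that e False by linarith
    then show ?thesis
      by (intro that[OF bil[of "-1"]]) (auto simp: B_def intro: orth[of "-1", unfolded B_def])
  qed
qed

theorem parallelogram: "(N (x + y))\<^sup>2 + (N (x - y))\<^sup>2 = 2 * (N x)\<^sup>2 + 2 * (N y)\<^sup>2"
proof -
  obtain B :: "vec3 \<Rightarrow> vec3 \<Rightarrow> real" where B: "bounded_bilinear B" "\<And>z. z \<noteq> 0 \<Longrightarrow> B z z > 0" "\<And>u z. B u z = 0 \<Longrightarrow> N z \<le> N (z + u)"
    by (rule ex_bilinear_orth, rule that) simp_all
  interpret B: bounded_bilinear B by (rule B(1))
  define e :: vec3 where "e = (1, 0, 0)"
  have e: "e \<noteq> 0" by (simp add: e_def prod_eq_iff)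
  \<comment> \<open>Each \<open>z\<close> off the line of \<open>e\<close> is compared with
    \<open>e\<close> inside the plane they span.\<close>
  have "(N z)\<^sup>2 * B e e = (N e)\<^sup>2 * B z z" for z
  proof (cases "\<exists>r. z = r *\<^sub>R e")
    case True
    then show ?thesis by (auto simp: scale B.scaleR_left B.scaleR_right power_mult_distrib power2_eq_square)
  next
    case False
    have indep: "s = 0 \<and> t = 0" if "s *\<^sub>R z + t *\<^sub>R e = 0" for s t
    proof -
      have "s = 0"
      proof (rule ccontr)
        assume "s \<noteq> 0"
        then have "z = (1 / s) *\<^sub>R (s *\<^sub>R z)" by simp
        also have "s *\<^sub>R z = - (t *\<^sub>R e)" using that by (rule eq_neg_iff_add_eq_0[THEN iffD2])
        finally have "z = (- t / s) *\<^sub>R e" by simp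
        then show False using False by blast
      qed
      then show ?thesis using that e by simp
    qed
    show ?thesis
      by (rule quadratic_of_bilinear_orthogonality[OF cont scale pos B indep])
  qed
  then have eq: "(N z)\<^sup>2 = (N e)\<^sup>2 * B z z / B e e" for z
    using B(2)[OF e] by (simp add: nonzero_eq_divide_eq)
  define K where "K = (N e)\<^sup>2 / B e e"
  have N: "(N z)\<^sup>2 = K * B z z" for z
    unfolding K_def times_divide_eq_left by (rule eq)
  have "B (x + y) (x + y) + B (x - y) (x - y) = 2 * B x x + 2 * B y y"
    by (simp add: B.add_left B.add_right B.diff_left B.diff_right)
  then have "C * (B (x + y) (x + y) + B (x - y) (x - y)) = C * (2 * B x x + 2 * B y y)" for C
    by (rule arg_cong)
  then have "C * B (x + y) (x + y) + C * B (x - y) (x - y) = 2 * (C * B x x) + 2 * (C * B y y)" for C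
    by (simp only: distrib_left mult.left_commute[of C 2])
  then show ?thesis unfolding N .
qed

end

section \<open>Two-dimensional spaces\<close>

text \<open>In dimension two the hyperplane projections carry no information. Instead, the quadratic form
  of largest discriminant below the squared norm is unique, hence invariant under all isometries.\<close>

definition quad :: "real \<times> real \<times> real \<Rightarrow> real \<Rightarrow> real \<Rightarrow> real" where
  "quad = (\<lambda>(A, B, C) a b. A * a\<^sup>2 + 2 * B * a * b + C * b\<^sup>2)"

text \<open>The determinant of the form's matrix. For forms below the squared norm the ellipse
  contains the unit ball, and a larger determinant means a smaller area: the maximiser is the
  Loewner ellipse.\<close>

definition discr :: "real \<times> real \<times> real \<Rightarrow> real" where
  "discr = (\<lambda>(A, B, C). A * C - B\<^sup>2)"

definition forms_below :: "(real \<Rightarrow> real \<Rightarrow> real) \<Rightarrow> (real \<times> real \<times> real) set" where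
  "forms_below M = {q. \<forall>a b. 0 \<le> quad q a b \<and> quad q a b \<le> (M a b)\<^sup>2}"

text \<open>The values at \<open>(1, 0)\<close>, \<open>(0, 1)\<close> and \<open>(1, 1)\<close>
  bound all three coefficients, and every defining condition is closed.\<close>

lemma compact_forms_below: "compact (forms_below M)"
proof -
  have "closed {q. 0 \<le> quad q a b \<and> quad q a b \<le> (M a b)\<^sup>2}" for a b
    unfolding quad_def case_prod_beta by (intro closed_Collect_conj closed_Collect_le continuous_intros)
  then have "closed (\<Inter>a. \<Inter>b. {q. 0 \<le> quad q a b \<and> quad q a b \<le> (M a b)\<^sup>2})"
    by (intro closed_INT ballI)
  moreover have "(\<Inter>a. \<Inter>b. {q. 0 \<le> quad q a b \<and> quad q a b \<le> (M a b)\<^sup>2}) = forms_below M"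
    by (auto simp: forms_below_def)
  ultimately have closed: "closed (forms_below M)" by simp
  define m where "m = (M 1 0)\<^sup>2 + (M 0 1)\<^sup>2 + (M 1 1)\<^sup>2"
  have "forms_below M \<subseteq> {0..m} \<times> {-m..m} \<times> {0..m}"
  proof (rule subsetI)
    fix q assume q: "q \<in> forms_below M"
    obtain A B C where [simp]: "q = (A, B, C)" by (metis prod_cases3)
    have "0 \<le> quad q a b" "quad q a b \<le> (M a b)\<^sup>2" for a b using q by (auto simp: forms_below_def)
    from this[of 1 0] this[of 0 1] this[of 1 1]
    have "0 \<le> A" "A \<le> (M 1 0)\<^sup>2" "0 \<le> C" "C \<le> (M 0 1)\<^sup>2" "0 \<le> A + 2 * B + C" "A + 2 * B + C \<le> (M 1 1)\<^sup>2"
      by (simp_all add: quad_def)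
    moreover have "(M 1 0)\<^sup>2 \<ge> 0" "(M 0 1)\<^sup>2 \<ge> 0" "(M 1 1)\<^sup>2 \<ge> 0" by simp_all
    ultimately have "0 \<le> A \<and> A \<le> m \<and> - m \<le> B \<and> B \<le> m \<and> 0 \<le> C \<and> C \<le> m"
      unfolding m_def by linarith
    then show "q \<in> {0..m} \<times> {-m..m} \<times> {0..m}" by simp
  qed
  moreover have "compact ({0..m} \<times> {-m..m} \<times> {0..m})" by (intro compact_Times compact_Icc)
  ultimately show ?thesis using closed by (metis compact_Int_closed inf.absorb_iff2)
qed

text \<open>The midpoint of two admissible forms is admissible, and strict concavity would give it a
  larger discriminant than two distinct maximisers.\<close>

lemma forms_below_max_unique:
  assumes q1: "q1 \<in> forms_below M" and q2: "q2 \<in> forms_below M"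
    and max: "\<And>q. q \<in> forms_below M \<Longrightarrow> discr q \<le> D"
    and D: "discr q1 = D" "discr q2 = D" "D > 0"
  shows "q1 = q2"
proof -
  obtain A1 B1 C1 A2 B2 C2 where q [simp]: "q1 = (A1, B1, C1)" "q2 = (A2, B2, C2)" by (metis prod_cases3)
  have "((A1 + A2) / 2, (B1 + B2) / 2, (C1 + C2) / 2) \<in> forms_below M"
    unfolding forms_below_def
  proof (intro CollectI allI)
    fix a b
    have "quad ((A1 + A2) / 2, (B1 + B2) / 2, (C1 + C2) / 2) a b = (quad q1 a b + quad q2 a b) / 2"
      by (simp add: quad_def field_simps)
    moreover have "0 \<le> quad q1 a b" "quad q1 a b \<le> (M a b)\<^sup>2" "0 \<le> quad q2 a b" "quad q2 a b \<le> (M a b)\<^sup>2"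
      using q1 q2 unfolding forms_below_def by blast+
    ultimately show "0 \<le> quad ((A1 + A2) / 2, (B1 + B2) / 2, (C1 + C2) / 2) a b \<and>
        quad ((A1 + A2) / 2, (B1 + B2) / 2, (C1 + C2) / 2) a b \<le> (M a b)\<^sup>2"
      by simp
  qed
  from max[OF this] have mid: "(A1 + A2) * (C1 + C2) - (B1 + B2)\<^sup>2 \<le> 4 * D"
    by (simp add: discr_def field_simps power2_eq_square)
  have d: "A1 * C1 = D + B1\<^sup>2" "A2 * C2 = D + B2\<^sup>2" using D by (simp_all add: discr_def)
  have "quad q1 1 0 \<ge> 0" "quad q2 1 0 \<ge> 0" using q1 q2 unfolding forms_below_def by blast+
  then have "A1 \<ge> 0" "A2 \<ge> 0" by (simp_all add: quad_def)
  moreover have "A1 * C1 > 0" "A2 * C2 > 0" unfolding d using D(3) by (simp_all add: add_pos_nonneg)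
  ultimately have A: "A1 > 0" "A2 > 0" by (auto simp: order_le_less)
  have "A1 * C2 + A2 * C1 - 2 * B1 * B2 \<le> 2 * D"
    using mid d by (simp add: algebra_simps power2_eq_square)
  \<comment> \<open>Multiplying by \<open>A1 * A2\<close> and substituting \<open>d\<close> makes
    the inequality say that two nonnegative terms have sum at most 0.\<close>
  then have "A1 * A2 * (A1 * C2 + A2 * C1 - 2 * B1 * B2) \<le> A1 * A2 * (2 * D)"
    using A by (intro mult_left_mono) auto
  moreover have "A1 * A2 * (A1 * C2 + A2 * C1 - 2 * B1 * B2)
      = A1\<^sup>2 * (A2 * C2) + A2\<^sup>2 * (A1 * C1) - 2 * A1 * A2 * B1 * B2"
    by (simp add: algebra_simps power2_eq_square)
  ultimately have "D * (A1 - A2)\<^sup>2 + (A1 * B2 - A2 * B1)\<^sup>2 \<le> 0"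
    unfolding d by (simp add: algebra_simps power2_eq_square)
  moreover have "D * (A1 - A2)\<^sup>2 \<ge> 0" "(A1 * B2 - A2 * B1)\<^sup>2 \<ge> 0" using D by simp_all
  ultimately have "D * (A1 - A2)\<^sup>2 = 0" "(A1 * B2 - A2 * B1)\<^sup>2 = 0" by linarith+
  then have AA: "A1 = A2" and "A1 * B2 = A2 * B1" using D by simp_all
  then have BB: "B1 = B2" using A by simp
  then have "C1 = C2" using d AA A by (metis mult_cancel_left less_irrefl)
  then show ?thesis using AA BB by simp
qed

text \<open>The extremal form \<open>Q\<close> is invariant under isometries. Every unit vector is a
  weak limit of orbit points of \<open>u\<close>, and coordinates are bounded functionals, so
  \<open>Q\<close> is constant on the unit sphere.\<close>

lemma two_dim_parallelogram:
  fixes x y :: "'a::real_normed_vector"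
  assumes LUR: "omega_LUR TYPE('a)" and big: "big_point (u::'a)"
    and indep: "\<And>s t. s *\<^sub>R x + t *\<^sub>R y = 0 \<Longrightarrow> s = 0 \<and> t = 0"
    and gen: "\<And>z. \<exists>a b. z = a *\<^sub>R x + b *\<^sub>R y"
  shows "(norm (v + w))\<^sup>2 + (norm (v - w))\<^sup>2 = 2 * (norm v)\<^sup>2 + 2 * (norm (w::'a))\<^sup>2"
proof -
  define M where "M a b = norm (a *\<^sub>R x + b *\<^sub>R y)" for a b
  obtain \<alpha> \<beta> where \<alpha>\<beta>: "\<And>z. z = \<alpha> z *\<^sub>R x + \<beta> z *\<^sub>R y" using gen by metis
  have coord: "\<alpha> z = a \<and> \<beta> z = b" if "z = a *\<^sub>R x + b *\<^sub>R y" for z a b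
  proof -
    have "(\<alpha> z - a) *\<^sub>R x + (\<beta> z - b) *\<^sub>R y = (\<alpha> z *\<^sub>R x + \<beta> z *\<^sub>R y) - (a *\<^sub>R x + b *\<^sub>R y)"
      by (simp add: algebra_simps)
    also have "\<dots> = 0" using \<alpha>\<beta>[of z] that by simp
    finally show ?thesis using indep by fastforce
  qed
  have add: "\<alpha> (z + z') = \<alpha> z + \<alpha> z'" "\<beta> (z + z') = \<beta> z + \<beta> z'" for z z'
  proof -
    have "z + z' = (\<alpha> z *\<^sub>R x + \<beta> z *\<^sub>R y) + (\<alpha> z' *\<^sub>R x + \<beta> z' *\<^sub>R y)"
      using \<alpha>\<beta>[of z] \<alpha>\<beta>[of z'] by simp
    also have "\<dots> = (\<alpha> z + \<alpha> z') *\<^sub>R x + (\<beta> z + \<beta> z') *\<^sub>R y" by (simp add: algebra_simps)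
    finally show "\<alpha> (z + z') = \<alpha> z + \<alpha> z'" "\<beta> (z + z') = \<beta> z + \<beta> z'" using coord by blast+
  qed
  have scale: "\<alpha> (c *\<^sub>R z) = c * \<alpha> z" "\<beta> (c *\<^sub>R z) = c * \<beta> z" for c z
  proof -
    have "c *\<^sub>R z = c *\<^sub>R (\<alpha> z *\<^sub>R x + \<beta> z *\<^sub>R y)" using \<alpha>\<beta>[of z] by simp
    also have "\<dots> = (c * \<alpha> z) *\<^sub>R x + (c * \<beta> z) *\<^sub>R y" by (simp add: algebra_simps)
    finally show "\<alpha> (c *\<^sub>R z) = c * \<alpha> z" "\<beta> (c *\<^sub>R z) = c * \<beta> z" using coord by blast+
  qed
  \<comment> \<open>The squared minimum of the norm on the Euclidean circle. It makes the
    coordinates bounded functionals and \<open>(m, 0, m)\<close> an admissible form with positive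
    discriminant.\<close>
  obtain m where m: "m > 0" "\<And>a b. m * (a\<^sup>2 + b\<^sup>2) \<le> (M a b)\<^sup>2"
  proof -
    define S where "S = sphere (0 :: real \<times> real) 1"
    have "continuous_on S (\<lambda>p. M (fst p) (snd p))"
      unfolding M_def by (intro continuous_intros)
    moreover have "compact S" by (simp add: S_def)
    moreover have "(1, 0) \<in> S" by (simp add: S_def norm_Pair)
    ultimately obtain p where p: "p \<in> S" "\<And>r. r \<in> S \<Longrightarrow> M (fst p) (snd p) \<le> M (fst r) (snd r)"
      using continuous_attains_inf[of S "\<lambda>p. M (fst p) (snd p)"] by blast
    define \<mu> where "\<mu> = M (fst p) (snd p)"
    have "\<mu> > 0"
    proof -
      have "p \<noteq> 0" using p(1) by (auto simp: S_def)
      then have "fst p \<noteq> 0 \<or> snd p \<noteq> 0" by (auto simp: prod_eq_iff)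
      then have "fst p *\<^sub>R x + snd p *\<^sub>R y \<noteq> 0" using indep by blast
      then show ?thesis by (simp add: \<mu>_def M_def)
    qed
    have "\<mu>\<^sup>2 * (a\<^sup>2 + b\<^sup>2) \<le> (M a b)\<^sup>2" for a b
    proof (cases "a = 0 \<and> b = 0")
      case False
      define r where "r = sqrt (a\<^sup>2 + b\<^sup>2)"
      have r: "r > 0" using False by (simp add: r_def sum_power2_gt_zero_iff)
      have r2: "r\<^sup>2 = a\<^sup>2 + b\<^sup>2" by (simp add: r_def)
      have "(a / r)\<^sup>2 + (b / r)\<^sup>2 = 1"
        using r by (simp add: power_divide flip: add_divide_distrib r2)
      then have "(a / r, b / r) \<in> S" by (simp add: S_def norm_Pair power_divide)
      then have "\<mu> \<le> M (a / r) (b / r)" using p(2) by (fastforce simp: \<mu>_def)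
      also have "\<dots> = norm ((1 / r) *\<^sub>R (a *\<^sub>R x + b *\<^sub>R y))" by (simp add: M_def scaleR_add_right)
      also have "\<dots> = M a b / r" using r by (simp add: M_def)
      finally have "\<mu> * r \<le> M a b" using r by (simp add: field_simps)
      then have "(\<mu> * r)\<^sup>2 \<le> (M a b)\<^sup>2" using \<open>\<mu> > 0\<close> r by (intro power_mono) auto
      then show ?thesis by (simp add: power_mult_distrib r2)
    qed simp
    then show thesis using that[of "\<mu>\<^sup>2"] \<open>\<mu> > 0\<close> by simp
  qed
  have bl: "bounded_linear \<alpha>" "bounded_linear \<beta>"
  proof -
    have "m * ((\<alpha> z)\<^sup>2 + (\<beta> z)\<^sup>2) \<le> (norm z)\<^sup>2" for z
      using m(2)[of "\<alpha> z" "\<beta> z"] \<alpha>\<beta>[of z] by (simp add: M_def)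
    then have *: "(\<alpha> z)\<^sup>2 + (\<beta> z)\<^sup>2 \<le> (norm z / sqrt m)\<^sup>2" for z
      using m(1) by (simp add: power_divide pos_le_divide_eq mult.commute)
    have "\<bar>\<alpha> z\<bar> \<le> norm z / sqrt m" "\<bar>\<beta> z\<bar> \<le> norm z / sqrt m" for z
    proof -
      have "(\<alpha> z)\<^sup>2 \<le> (norm z / sqrt m)\<^sup>2" "(\<beta> z)\<^sup>2 \<le> (norm z / sqrt m)\<^sup>2"
        using *[of z] zero_le_power2[of "\<alpha> z"] zero_le_power2[of "\<beta> z"] by linarith+
      moreover have "norm z / sqrt m \<ge> 0" using m(1) by simp
      ultimately show "\<bar>\<alpha> z\<bar> \<le> norm z / sqrt m" "\<bar>\<beta> z\<bar> \<le> norm z / sqrt m"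
        by (metis abs_le_square_iff abs_of_nonneg)+
    qed
    then show "bounded_linear \<alpha>" "bounded_linear \<beta>"
      by (auto intro!: bounded_linear_intro[where K = "1 / sqrt m"] simp: add scale)
  qed
  have "0 \<in> forms_below M" by (simp add: forms_below_def quad_def case_prod_beta)
  moreover have "continuous_on (forms_below M) discr"
    unfolding discr_def case_prod_beta by (intro continuous_intros)
  ultimately obtain q0 where q0: "q0 \<in> forms_below M" and max: "\<And>q. q \<in> forms_below M \<Longrightarrow> discr q \<le> discr q0"
    using continuous_attains_sup[OF compact_forms_below] by blast
  have "(m, 0, m) \<in> forms_below M"
    using m by (auto simp: forms_below_def quad_def distrib_left)
  then have "discr (m, 0, m) \<le> discr q0" by (rule max)
  moreover have "discr (m, 0, m) > 0" using m(1) by (simp add: discr_def)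
  ultimately have D: "discr q0 > 0" by linarith
  obtain A B C where q0_eq: "q0 = (A, B, C)" by (metis prod_cases3)
  define Q where "Q z = quad q0 (\<alpha> z) (\<beta> z)" for z
  \<comment> \<open>The coefficients of \<open>Q\<close> composed with \<open>T\<close> in the basis
    \<open>x\<close>, \<open>y\<close>; \<open>\<delta> T\<close> below is the determinant of
    \<open>T\<close>.\<close>
  define pull where "pull T = (Q (T x),
      A * \<alpha> (T x) * \<alpha> (T y) + B * (\<alpha> (T x) * \<beta> (T y) + \<beta> (T x) * \<alpha> (T y)) + C * \<beta> (T x) * \<beta> (T y),
      Q (T y))" for T
  define \<delta> where "\<delta> T = \<alpha> (T x) * \<beta> (T y) - \<beta> (T x) * \<alpha> (T y)" for T
  have \<alpha>T: "\<alpha> (T z) = \<alpha> z * \<alpha> (T x) + \<beta> z * \<alpha> (T y)" "\<beta> (T z) = \<alpha> z * \<beta> (T x) + \<beta> z * \<beta> (T y)"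
    if T: "T \<in> isometry_group" for T z
  proof -
    have "T z = T (\<alpha> z *\<^sub>R x + \<beta> z *\<^sub>R y)" using \<alpha>\<beta>[of z] by simp
    then have Tz: "T z = \<alpha> z *\<^sub>R T x + \<beta> z *\<^sub>R T y"
      by (simp add: linear_add[OF isometry_group_linear[OF T]] linear_scale[OF isometry_group_linear[OF T]])
    show "\<alpha> (T z) = \<alpha> z * \<alpha> (T x) + \<beta> z * \<alpha> (T y)" "\<beta> (T z) = \<alpha> z * \<beta> (T x) + \<beta> z * \<beta> (T y)"
      unfolding Tz add scale by simp_all
  qed
  have quad_pull: "quad (pull T) (\<alpha> z) (\<beta> z) = Q (T z)" if "T \<in> isometry_group" for T z
    unfolding Q_def \<alpha>T[OF that, of z] by (simp add: pull_def Q_def quad_def q0_eq algebra_simps power2_eq_square)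
  have pull_mem: "pull T \<in> forms_below M" if T: "T \<in> isometry_group" for T
    unfolding forms_below_def
  proof (intro CollectI allI)
    fix a b
    define z where "z = a *\<^sub>R x + b *\<^sub>R y"
    have z: "\<alpha> z = a" "\<beta> z = b" using coord z_def by blast+
    have "quad (pull T) a b = Q (T z)" using quad_pull[OF T, of z] by (simp add: z)
    moreover have "0 \<le> Q (T z)" "Q (T z) \<le> (M (\<alpha> (T z)) (\<beta> (T z)))\<^sup>2"
      using q0 unfolding forms_below_def Q_def by blast+
    moreover have "M (\<alpha> (T z)) (\<beta> (T z)) = M a b"
      using isometry_group_norm[OF T, of z] \<alpha>\<beta>[of "T z"] by (simp add: M_def z_def)
    ultimately show "0 \<le> quad (pull T) a b \<and> quad (pull T) a b \<le> (M a b)\<^sup>2" by simp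
  qed
  have discr_pull: "discr (pull T) = discr q0 * (\<delta> T)\<^sup>2" for T
    by (simp add: discr_def pull_def Q_def quad_def \<delta>_def q0_eq) algebra
  have \<delta>_le: "(\<delta> T)\<^sup>2 \<le> 1" if "T \<in> isometry_group" for T
    using max[OF pull_mem[OF that]] D by (simp add: discr_pull)
  have Q_inv: "Q (T z) = Q z" if T: "T \<in> isometry_group" for T z
  proof -
    have xy: "\<alpha> x = 1" "\<beta> x = 0" "\<alpha> y = 0" "\<beta> y = 1"
      using coord[of x 1 0] coord[of y 0 1] by simp_all
    note S = isometry_group_inv[OF T]
    \<comment> \<open>Maximality allows neither \<open>T\<close> nor its inverse a determinant
      beyond 1 in absolute value; as the product is 1, both are extremal and uniqueness applies to
      \<open>pull T\<close>.\<close>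
    have "\<delta> (inv T) * \<delta> T = 1"
    proof -
      have "\<alpha> (inv T (T x)) = 1" "\<beta> (inv T (T x)) = 0" "\<alpha> (inv T (T y)) = 0" "\<beta> (inv T (T y)) = 1"
        by (simp_all add: S xy)
      then show ?thesis unfolding \<alpha>T[OF S(1), of "T x"] \<alpha>T[OF S(1), of "T y"] \<delta>_def by algebra
    qed
    then have "(\<delta> (inv T))\<^sup>2 * (\<delta> T)\<^sup>2 = 1" by (metis power_mult_distrib power_one)
    moreover have "(\<delta> (inv T))\<^sup>2 * (\<delta> T)\<^sup>2 \<le> 1 * (\<delta> T)\<^sup>2"
      using \<delta>_le[OF S(1)] by (intro mult_right_mono) auto
    ultimately have "(\<delta> T)\<^sup>2 = 1" using \<delta>_le[OF T] by simp
    then have "discr (pull T) = discr q0" by (simp add: discr_pull)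
    then have "pull T = q0"
      using forms_below_max_unique[OF pull_mem[OF T] q0 max] D by simp
    then show ?thesis using quad_pull[OF T, of z] by (simp add: Q_def)
  qed
  define \<kappa> where "\<kappa> = Q u"
  have nu: "norm u = 1" using big by (simp add: big_point_def)
  have unit: "Q z = \<kappa>" if z: "norm z = 1" for z
  proof -
    obtain T where T: "\<And>n. T n \<in> isometry_group" "weakly_tendsto (\<lambda>n. T n u) z"
      using omega_LUR_orbit[OF LUR big nu z] by blast
    have "(\<lambda>n. \<alpha> (T n u)) \<longlonglongrightarrow> \<alpha> z" "(\<lambda>n. \<beta> (T n u)) \<longlonglongrightarrow> \<beta> z"
      using weakly_tendstoD[OF T(2)] bl by blast+
    then have "(\<lambda>n. Q (T n u)) \<longlonglongrightarrow> Q z"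
      unfolding Q_def quad_def case_prod_beta by (intro tendsto_intros)
    then show ?thesis using Q_inv[OF T(1)] by (simp add: \<kappa>_def LIMSEQ_const_iff)
  qed
  have Q_scale: "Q (c *\<^sub>R z) = c\<^sup>2 * Q z" for c z
    by (simp add: Q_def scale quad_def case_prod_beta algebra_simps power2_eq_square)
  have Q: "Q z = \<kappa> * (norm z)\<^sup>2" for z
  proof (cases "z = 0")
    case True then show ?thesis using Q_scale[of 0 z] by simp
  next
    case False
    then have "Q (norm z *\<^sub>R (z /\<^sub>R norm z)) = (norm z)\<^sup>2 * \<kappa>"
      using unit[of "z /\<^sub>R norm z"] by (simp only: Q_scale) simp
    then show ?thesis using False by (simp add: mult.commute)
  qed
  have "\<kappa> \<noteq> 0"
  proof
    assume "\<kappa> = 0"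
    then have "Q z = 0" for z using Q by simp
    then have "Q x = 0" "Q y = 0" "Q (x + y) = 0" by blast+
    then have "A = 0" "C = 0" "B = 0"
      using coord[of x 1 0] coord[of y 0 1] coord[of "x + y" 1 1] by (simp_all add: Q_def quad_def q0_eq)
    then show False using D by (simp add: discr_def q0_eq)
  qed
  have sub: "\<alpha> (v - w) = \<alpha> v - \<alpha> w" "\<beta> (v - w) = \<beta> v - \<beta> w"
    using add[of "v - w" w] by simp_all
  have "Q (v + w) + Q (v - w) = 2 * Q v + 2 * Q w"
    by (simp add: Q_def add sub quad_def case_prod_beta algebra_simps power2_eq_square)
  then have "\<kappa> * ((norm (v + w))\<^sup>2 + (norm (v - w))\<^sup>2) = \<kappa> * (2 * (norm v)\<^sup>2 + 2 * (norm w)\<^sup>2)"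
    unfolding Q by (simp add: algebra_simps)
  then show ?thesis using \<open>\<kappa> \<noteq> 0\<close> by simp
qed

section \<open>The parallelogram law\<close>

lemma additive_continuous_real:
  fixes f :: "real \<Rightarrow> real"
  assumes add: "\<And>x y. f (x + y) = f x + f y" and cont: "continuous_on UNIV f"
  shows "f t = t * f 1"
proof -
  have zero: "f 0 = 0" using add[of 0 0] by simp
  have neg: "f (- x) = - f x" for x using add[of x "- x"] zero by simp
  have nat: "f (of_nat n * x) = of_nat n * f x" for n x
    by (induction n) (simp_all add: zero distrib_right add)
  have int: "f (of_int n * x) = of_int n * f x" for n x
  proof (cases "n \<ge> 0")
    case True then show ?thesis using nat[of "nat n" x] by simp
  next
    case False
    then have n: "(of_int n :: real) = - of_nat (nat (- n))" by simp
    show ?thesis unfolding n mult_minus_left neg nat ..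
  qed
  have rat: "f q = q * f 1" if q: "q \<in> \<rat>" for q
  proof -
    obtain a b where ab: "b \<noteq> 0" "q = of_int a / of_int b"
      using q by (auto simp: Rats_eq_int_div_int)
    then have "of_int b * q = of_int a * 1" by simp
    then have "of_int b * f q = of_int a * f 1" using int[of b q] int[of a 1] by simp
    then have "f q = of_int a * f 1 / of_int b" using ab(1) by (simp add: nonzero_eq_divide_eq mult.commute)
    then show ?thesis using ab(2) by simp
  qed
  have "closed {t. f t = t * f 1}"
    by (intro closed_Collect_eq continuous_intros cont)
  moreover have "\<rat> \<subseteq> {t. f t = t * f 1}" using rat by blast
  ultimately have "closure \<rat> \<subseteq> {t. f t = t * f 1}" by (intro closure_minimal)
  then show ?thesis by (auto simp: Rats_closure_real)
qed

text \<open>\<open>f\<close> is four times the polarised inner product. The parallelogram law at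
  \<open>a + y\<close> and \<open>a - y\<close> yields the midpoint identity \<open>mid\<close>,
  whence additivity; continuity of the norm upgrades this to homogeneity.\<close>

theorem jordan_von_neumann:
  assumes par: "\<And>x y :: 'a::real_normed_vector.
      (norm (x + y))\<^sup>2 + (norm (x - y))\<^sup>2 = 2 * (norm x)\<^sup>2 + 2 * (norm y)\<^sup>2"
  shows "norm_from_inner_product TYPE('a)"
proof -
  define f :: "'a \<Rightarrow> 'a \<Rightarrow> real" where "f x y = (norm (x + y))\<^sup>2 - (norm (x - y))\<^sup>2" for x y
  have mid: "f (a + b) y + f (a - b) y = 2 * f a y" for a b y
  proof -
    have "(norm (a + b + y))\<^sup>2 + (norm (a - b + y))\<^sup>2 = 2 * (norm (a + y))\<^sup>2 + 2 * (norm b)\<^sup>2"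
      using par[of "a + y" b] by (simp add: algebra_simps)
    moreover have "(norm (a + b - y))\<^sup>2 + (norm (a - b - y))\<^sup>2 = 2 * (norm (a - y))\<^sup>2 + 2 * (norm b)\<^sup>2"
      using par[of "a - y" b] by (simp add: algebra_simps)
    ultimately show ?thesis unfolding f_def by algebra
  qed
  have zero: "f 0 y = 0" for y by (simp add: f_def)
  have double: "f (a + a) y = 2 * f a y" for a y using mid[of a a y] zero by simp
  have add: "f (a + b) y = f a y + f b y" for a b y
  proof -
    define c d where "c = (1 / 2) *\<^sub>R (a + b)" and "d = (1 / 2) *\<^sub>R (a - b)"
    have "c + d = a" "c - d = b"
      by (simp_all add: c_def d_def flip: scaleR_add_right scaleR_diff_right scaleR_2)
    moreover have "c + c = a + b" by (simp add: c_def flip: scaleR_2)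
    ultimately show ?thesis using mid[of c d y] double[of c y] by simp
  qed
  have scale: "f (t *\<^sub>R a) y = t * f a y" for t a y
  proof -
    have "f (t *\<^sub>R a) y = t * f (1 *\<^sub>R a) y"
    proof (rule additive_continuous_real)
      show "f ((s + t) *\<^sub>R a) y = f (s *\<^sub>R a) y + f (t *\<^sub>R a) y" for s t
        by (simp add: scaleR_add_left add)
      show "continuous_on UNIV (\<lambda>t. f (t *\<^sub>R a) y)"
        unfolding f_def by (intro continuous_intros)
    qed
    then show ?thesis by simp
  qed
  have sym: "f a b = f b a" for a b by (simp add: f_def add.commute norm_minus_commute)
  have sq: "f a a = 4 * (norm a)\<^sup>2" for a
    by (simp add: f_def power_mult_distrib flip: scaleR_2)
  show ?thesis
    unfolding norm_from_inner_product_def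
  proof (intro exI[of _ "\<lambda>a b. f a b / 4"] conjI allI)
    show "linear (\<lambda>a. f a b / 4)" for b by (rule linearI) (simp_all add: add scale add_divide_distrib)
    show "f a b / 4 = f b a / 4" for a b using sym by simp
    show "norm a = sqrt (f a a / 4)" for a by (simp add: sq)
  qed
qed

text \<open>The vector \<open>w\<close> serves only to open a third dimension, in which the almost
  projections acquire an exact limit.\<close>

lemma parallelogram_of_three_independent:
  fixes x y w :: "'a::real_normed_vector"
  assumes LUR: "omega_LUR TYPE('a)" and big: "big_point (b::'a)"
    and proj: "\<forall>\<epsilon>>0. \<exists>Z :: 'a set. codim1_closed_subspace Z \<and>
            (\<exists>P. is_projection_onto_with_norm P Z (1 + \<epsilon>))"
    and indep: "\<And>r s t. r *\<^sub>R x + s *\<^sub>R y + t *\<^sub>R w = 0 \<Longrightarrow> r = 0 \<and> s = 0 \<and> t = 0"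
  shows "(norm (x + y))\<^sup>2 + (norm (x - y))\<^sup>2 = 2 * (norm x)\<^sup>2 + 2 * (norm y)\<^sup>2"
proof -
  define L :: "vec3 \<Rightarrow> 'a" where "L z = fst z *\<^sub>R x + fst (snd z) *\<^sub>R y + snd (snd z) *\<^sub>R w" for z
  have L_add: "L (z + z') = L z + L z'" for z z' by (simp add: L_def algebra_simps)
  have L_scale: "L (c *\<^sub>R z) = c *\<^sub>R L z" for c z by (simp add: L_def algebra_simps)
  have L_diff: "L (z - z') = L z - L z'" for z z' by (simp add: L_def algebra_simps)
  have L_0: "z = 0" if "L z = 0" for z
    using indep[of "fst z" "fst (snd z)" "snd (snd z)"] that by (simp add: L_def prod_eq_iff)
  have L_inj: "z = z'" if "L z = L z'" for z z'
    using L_0[of "z - z'"] that by (simp add: L_diff)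
  interpret flat_shadow_norm "\<lambda>z. norm (L z)"
  proof
    show "continuous_on UNIV (\<lambda>z. norm (L z))"
      unfolding L_def by (intro continuous_intros)
    show "norm (L (c *\<^sub>R z)) = \<bar>c\<bar> * norm (L z)" for c z by (simp add: L_scale)
    show "0 < norm (L z)" if "z \<noteq> 0" for z using L_0[of z] that by auto
    show "z = z'" if "norm (L z) = norm (L z')" "norm (L z) + norm (L z') \<le> norm (L (z + z'))" for z z'
      using omega_LUR_strictly_convex[OF LUR that(1)] that(2) L_inj by (simp add: L_add)
    fix u :: vec3 assume "u \<noteq> 0"
    then have Lu: "L u \<noteq> 0" using L_0 by blast
    define v where "v = L u /\<^sub>R norm (L u)"
    have nv: "norm v = 1" using Lu by (simp add: v_def)
    obtain W k where k: "\<And>n. linear (k n)" "\<And>n x. \<bar>k n x\<bar> \<le> 3 * norm x" "(\<lambda>n. k n v) \<longlonglongrightarrow> 1"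
      and W: "weakly_tendsto W v" "\<And>n x. norm (x - k n x *\<^sub>R W n) \<le> (1 + 1 / Suc n) * norm x"
      by (rule almost_projections_along_unit[OF LUR big proj nv], rule that) simp_all
    define K :: "nat \<Rightarrow> vec3" where "K n = (k n x, k n y, k n w)" for n
    have K: "k n (L z) = K n \<bullet> z" for n z
      by (simp add: K_def L_def linear_add[OF k(1)] linear_scale[OF k(1)] inner_prod_def mult.commute)
    \<comment> \<open>On the span a functional is its three values on \<open>x\<close>,
      \<open>y\<close>, \<open>w\<close>; the uniform bound 3 keeps these in a box, so a subsequence
      converges.\<close>
    have "K n \<in> cbox (- 3 * norm x, - 3 * norm y, - 3 * norm w) (3 * norm x, 3 * norm y, 3 * norm w)" for n
      using k(2)[of n x] k(2)[of n y] k(2)[of n w] unfolding K_def cbox_Pair_eq by (simp add: abs_le_iff minus_le_iff)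
    then obtain h r where r: "strict_mono r" "(K \<circ> r) \<longlonglongrightarrow> h"
      using compact_cbox[unfolded compact_eq_seq_compact_metric seq_compact_def] by metis
    have lim: "(\<lambda>n. k (r n) (L z)) \<longlonglongrightarrow> h \<bullet> z" for z
      unfolding K using r(2) by (intro tendsto_intros) (simp add: o_def)
    have hu: "h \<bullet> u = norm (L u)"
    proof -
      have "(\<lambda>n. norm (L u) * k (r n) v) \<longlonglongrightarrow> norm (L u) * 1"
        by (intro tendsto_intros LIMSEQ_subseq_LIMSEQ[OF k(3) r(1), unfolded o_def])
      moreover have "norm (L u) * k n v = k n (L u)" for n
        using Lu by (simp add: v_def linear_scale[OF k(1)])
      ultimately show ?thesis using LIMSEQ_unique[OF lim[of u]] by simp
    qed
    \<comment> \<open>The vectors \<open>W (r n)\<close> may leave the span and only their weak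
      limit \<open>v\<close> is known to lie in it, so the estimate is passed to the limit in the
      ambient space.\<close>
    have le: "norm (L z - (h \<bullet> z) *\<^sub>R v) \<le> norm (L z)" for z
    proof (rule weakly_tendsto_norm_le)
      show "weakly_tendsto (\<lambda>n. L z - k (r n) (L z) *\<^sub>R W (r n)) (L z - (h \<bullet> z) *\<^sub>R v)"
        unfolding weakly_tendsto_def
      proof (intro allI impI)
        fix g :: "'a \<Rightarrow> real" assume g: "bounded_linear g"
        note lin = bounded_linear.linear[OF g]
        have "(\<lambda>n. g (W (r n))) \<longlonglongrightarrow> g v"
          using LIMSEQ_subseq_LIMSEQ[OF weakly_tendstoD[OF W(1) g] r(1)] by (simp add: o_def)
        then show "(\<lambda>n. g (L z - k (r n) (L z) *\<^sub>R W (r n))) \<longlonglongrightarrow> g (L z - (h \<bullet> z) *\<^sub>R v)"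
          by (simp add: linear_diff[OF lin] linear_scale[OF lin] tendsto_intros lim)
      qed
      show "norm (L z - k (r n) (L z) *\<^sub>R W (r n)) \<le> (1 + 1 / Suc (r n)) * norm (L z)" for n by (rule W(2))
      have "(\<lambda>n. 1 / Suc (r n)) \<longlonglongrightarrow> 0"
        using LIMSEQ_subseq_LIMSEQ[OF LIMSEQ_inverse_real_of_nat r(1)] by (simp add: o_def inverse_eq_divide)
      then have "(\<lambda>n. (1 + 1 / Suc (r n)) * norm (L z)) \<longlonglongrightarrow> (1 + 0) * norm (L z)"
        by (intro tendsto_intros)
      then show "(\<lambda>n. (1 + 1 / Suc (r n)) * norm (L z)) \<longlonglongrightarrow> norm (L z)" by simp
    qed
    show "\<exists>h. h \<bullet> u = 1 \<and> (\<forall>z. norm (L (z - (h \<bullet> z) *\<^sub>R u)) \<le> norm (L z))"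
    proof (intro exI[of _ "h /\<^sub>R norm (L u)"] conjI allI)
      show "(h /\<^sub>R norm (L u)) \<bullet> u = 1" using hu Lu by simp
      show "norm (L (z - ((h /\<^sub>R norm (L u)) \<bullet> z) *\<^sub>R u)) \<le> norm (L z)" for z
        using le[of z] by (simp add: L_diff L_scale v_def mult.commute)
    qed
  qed
  show ?thesis
    using parallelogram[of "(1, 0, 0)" "(0, 1, 0)"] by (simp add: L_def)
qed

theorem theorem3p3:
  assumes "omega_LUR TYPE('a::banach)"
    and "\<exists>u :: 'a. big_point u"
    and "\<forall>\<epsilon>>0. \<exists>Z :: 'a set. codim1_closed_subspace Z \<and>
            (\<exists>P. is_projection_onto_with_norm P Z (1 + \<epsilon>))"
  shows "norm_from_inner_product TYPE('a)"
proof (rule jordan_von_neumann)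
  fix x y :: 'a
  obtain b :: 'a where b: "big_point b" using assms(2) ..
  show "(norm (x + y))\<^sup>2 + (norm (x - y))\<^sup>2 = 2 * (norm x)\<^sup>2 + 2 * (norm y)\<^sup>2"
  proof (cases "\<forall>s t. s *\<^sub>R x + t *\<^sub>R y = 0 \<longrightarrow> s = 0 \<and> t = 0")
    case False
    \<comment> \<open>Dependent vectors lie on one line, where the law is an identity between
      squares of real numbers.\<close>
    have multiple: "(norm (z + c *\<^sub>R z))\<^sup>2 + (norm (z - c *\<^sub>R z))\<^sup>2 = 2 * (norm z)\<^sup>2 + 2 * (norm (c *\<^sub>R z))\<^sup>2"
      for c and z :: 'a
    proof -
      have "z + c *\<^sub>R z = (1 + c) *\<^sub>R z" "z - c *\<^sub>R z = (1 - c) *\<^sub>R z" by (simp_all add: algebra_simps)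
      then show ?thesis by (simp add: power_mult_distrib) (simp add: algebra_simps power2_eq_square)
    qed
    obtain s t where st: "s *\<^sub>R x + t *\<^sub>R y = 0" "s \<noteq> 0 \<or> t \<noteq> 0" using False by blast
    have solve: "v = (- d / c) *\<^sub>R w" if "c *\<^sub>R v + d *\<^sub>R w = 0" "c \<noteq> 0" for c d and v w :: 'a
    proof -
      have "v = (1 / c) *\<^sub>R (c *\<^sub>R v)" using that(2) by simp
      also have "c *\<^sub>R v = - (d *\<^sub>R w)" using that(1) by (rule eq_neg_iff_add_eq_0[THEN iffD2])
      finally show ?thesis by simp
    qed
    show ?thesis
    proof (cases "s = 0")
      case False
      then obtain c where "x = c *\<^sub>R y" using solve[OF st(1)] by blast
      then show ?thesis using multiple[of y c] by (simp add: add.commute norm_minus_commute)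
    next
      case True
      then have "t \<noteq> 0" using st(2) by simp
      then obtain c where "y = c *\<^sub>R x" using solve[of t y s x] st(1) unfolding add.commute[of "s *\<^sub>R x"] by blast
      then show ?thesis using multiple[of x c] by simp
    qed
  next
    case indep: True
    show ?thesis
    proof (cases "\<forall>z. \<exists>c d. z = c *\<^sub>R x + d *\<^sub>R y")
      case True
      then show ?thesis
        using indep by (intro two_dim_parallelogram[OF assms(1) b, of x y]) auto
    next
      case False
      \<comment> \<open>A vector outside the span of \<open>x\<close> and \<open>y\<close> supplies
        the third dimension.\<close>
      then obtain w where w: "\<And>c d. w \<noteq> c *\<^sub>R x + d *\<^sub>R y" by blast
      show ?thesis
      proof (rule parallelogram_of_three_independent[OF assms(1) b assms(3)])
        fix r s t assume eq: "r *\<^sub>R x + s *\<^sub>R y + t *\<^sub>R w = 0"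
        have "t = 0"
        proof (rule ccontr)
          assume "t \<noteq> 0"
          then have "w = (1 / t) *\<^sub>R (t *\<^sub>R w)" by simp
          also have "t *\<^sub>R w = - (r *\<^sub>R x + s *\<^sub>R y)"
            using eq by (metis add.commute eq_neg_iff_add_eq_0)
          finally have "w = (- r / t) *\<^sub>R x + (- s / t) *\<^sub>R y" by (simp add: scaleR_diff_right scaleR_add_right)
          then show False using w by blast
        qed
        then show "r = 0 \<and> s = 0 \<and> t = 0" using eq indep by simp
      qed
    qed
  qed
qed

end
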